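(* In the directed FCFS bipartite matching model, assume the stability condition $\lambda_C<\mu_{\mathcal S(C)}$ for every nonempty $C\subseteq\mathcal C$. Then the stationary distribution of the Markov chain $Y(N)_{N\in\mathbb Z}$ is $$\pi_Y(C_1,n_1,\dots,C_k,n_k)=B\prod_{\ell=1}^k\frac{\lambda_{C_\ell}}{\mu_{\mathcal S(\{C_1,\dots,C_\ell\})}}\left(\frac{\lambda_{\{C_1,\dots,C_\ell\}}}{\mu_{\mathcal S(\{C_1,\dots,C_\ell\})}}\right)^{n_\ell},$$ where $B$ is a normalizing constant, which is also equal to the probability of a perfect match, i.e. $\pi_Y(\emptyset)=B$, and its value is $$B=\left(\sum_{k=0}^I\ \sum_{C\subseteq\mathcal C,\,|C|=k}\ \sum_{(C_1,\dots,C_k)\in\mathcal P(C)}\ \prod_{\ell=1}^k\frac{\lambda_{C_\ell}}{\mu_{\mathcal S(\{C_1,\dots,C_\ell\})}-\lambda_{\{C_1,\dots,C_\ell\}}}\right)^{-1},$$ where $\mathcal P(C)$ is the set of orderings (permutations) of $C$ and the $k=0$ term equals $1$.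
   Context: Model. $\mathcal C=\{c_1,\dots,c_I\}$ (agent types) and $\mathcal S=\{s_1,\dots,s_J\}$ (good types) are disjoint finite sets, $\mathcal G\subseteq\mathcal S\times\mathcal C$ is a bipartite compatibility graph, $\bar\lambda,\bar\mu>0$, and $\alpha,\beta$ are probability vectors on $\mathcal C,\mathcal S$. Put $\lambda_{c_i}=\bar\lambda\alpha_{c_i}$, $\mu_{s_j}=\bar\mu\beta_{s_j}$. The sequence $(z^n)_{n\in\mathbb Z}$ is i.i.d. with $P(z^n=c_i)=\lambda_{c_i}/(\bar\lambda+\bar\mu)$, $P(z^n=s_j)=\mu_{s_j}/(\bar\lambda+\bar\mu)$. For $C\subseteq\mathcal C$: $\mathcal S(C)=\{s_j:(s_j,c)\in\mathcal G\text{ for some }c\in C\}$, $\lambda_C=\sum_{c\in C}\lambda_c$; for $S\subseteq\mathcal S$: $\mu_S=\sum_{s\in S}\mu_s$. Directed FCFS matching: each good, upon its position in the sequence, is matched to the earliest still unmatched compatible agent among earlier positions, if one exists, and is otherwise lost. Formally, each item is matched at most once, and a good $z^n=s_j$ is matched with an agent $z^m=c_i$ if and only if (i) $n>m$; (ii) $(s_j,c_i)\in\mathcal G$; (iii) for every $k<m$ with $z^k=c_{i'}$ and $(s_j,c_{i'})\in\mathcal G$ there is $l<n$ such that $z^l$ is matched with $z^k$. Under the stability condition there is almost surely a unique such matching of $(z^n)_{n\in\mathbb Z}$ in which all agents are matched. $X(N)=(c^1,\dots,c^L)$ is the list, in order of position, of the types of the agents in positions $\le N$ not matched to goods in positions $\le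 N$ (a Markov chain). $Y(N)$ is obtained from $X(N)$: $Y(N)=\emptyset$ if $X(N)=\emptyset$. If $X(N)=(c^1,\dots,c^L)$, then $Y(N)=(C_1,n_1,\dots,C_k,n_k)$, where $C_1,\dots,C_k$ are the distinct agent types appearing in $X(N)$ in order of first appearance, $n_j\ge0$ for $j<k$ is the number of terms strictly between the first appearance of $C_j$ and the first appearance of $C_{j+1}$, and $n_k\ge0$ is the number of terms after the first appearance of $C_k$, so that $L=k+\sum_{j=1}^k n_j$.
   Formalization: The FCFS matching with all agents matched is not unique as described (backlogs growing towards the past are possible); the matching is additionally required to have no unmatched agents waiting at times arbitrarily far in the past, and its a.s. existence and uniqueness are proved. *)

theory Defs
  imports "HOL-Probability.Probability" "HOL-Combinatorics.Multiset_Permutations"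
begin

datatype ('c, 's) item =
    is_agent: Agent (agent_type: 'c)
  | is_good: Good (good_type: 's)

definition compatible_goods :: "('s \<times> 'c) set \<Rightarrow> 'c set \<Rightarrow> 's set" where
  "compatible_goods G C = {s. \<exists>c\<in>C. (s, c) \<in> G}"

(* A pair (n, m) in A means: the good in position n is matched with the agent in position m.
   The clause that no l < n is matched with m expresses that the agent is still unmatched when
   the good in position n is processed; without it the "if" direction would match an agent with
   every later compatible good, against the requirement of at most one match per item. *)
definition directed_fcfs_matching ::
  "('s \<times> 'c) set \<Rightarrow> (int \<Rightarrow> ('c, 's) item) \<Rightarrow> (int \<times> int) set \<Rightarrow> bool" where
  "directed_fcfs_matching G z A \<longleftrightarrow>
     single_valued A \<and> single_valued (A\<inverse>) \<and>
     (\<forall>n m. (n, m) \<in> A \<longleftrightarrow>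
        (\<exists>s c. z n = Good s \<and> z m = Agent c \<and> m < n \<and> (s, c) \<in> G \<and>
           \<not> (\<exists>l<n. (l, m) \<in> A) \<and>
           (\<forall>k<m. \<forall>c'. z k = Agent c' \<and> (s, c') \<in> G \<longrightarrow> (\<exists>l<n. (l, k) \<in> A))))"

definition all_agents_matched :: "(int \<Rightarrow> ('c, 's) item) \<Rightarrow> (int \<times> int) set \<Rightarrow> bool" where
  "all_agents_matched z A \<longleftrightarrow> (\<forall>m. is_agent (z m) \<longrightarrow> (\<exists>n. (n, m) \<in> A))"

definition waiting :: "(int \<Rightarrow> ('c, 's) item) \<Rightarrow> (int \<times> int) set \<Rightarrow> int \<Rightarrow> int set" where
  "waiting z A N = {m. m \<le> N \<and> is_agent (z m) \<and> \<not> (\<exists>n\<le>N. (n, m) \<in> A)}"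

(* Pathwise, "FCFS and all agents matched" does not determine the matching.  Take one agent type
   and one compatible good type, with goods more frequent than agents: enumerating the agents and
   the goods by the integers, one may match, for any sufficiently large K, the k-th good with the
   (k-K)-th agent for all k \<le> 0 and continue FCFS from there.  In these spurious solutions the
   number of waiting agents grows without bound towards the past.  The last conjunct, that there
   are epochs arbitrarily far in the past with nobody waiting, excludes them and singles out the
   stationary matching, the limit of the matchings started empty at time -T. *)
definition perfect_fcfs_matching ::
  "('s \<times> 'c) set \<Rightarrow> (int \<Rightarrow> ('c, 's) item) \<Rightarrow> (int \<times> int) set \<Rightarrow> bool" where
  "perfect_fcfs_matching G z A \<longleftrightarrow>
     directed_fcfs_matching G z A \<and> all_agents_matched z A \<and>
     (\<forall>N. \<exists>N'\<le>N. waiting z A N' = {})"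

definition fcfs_matching :: "('s \<times> 'c) set \<Rightarrow> (int \<Rightarrow> ('c, 's) item) \<Rightarrow> (int \<times> int) set" where
  "fcfs_matching G z = (THE A. perfect_fcfs_matching G z A)"

(* Under a perfect FCFS matching the set of waiting positions is finite, so sorted_list_of_set is
   not applied outside its intended domain. *)
definition X_state :: "('s \<times> 'c) set \<Rightarrow> (int \<Rightarrow> ('c, 's) item) \<Rightarrow> int \<Rightarrow> 'c list" where
  "X_state G z N =
     map (\<lambda>m. agent_type (z m)) (sorted_list_of_set (waiting z (fcfs_matching G z) N))"

definition first_appearances :: "'c list \<Rightarrow> nat list" where
  "first_appearances xs = filter (\<lambda>i. xs ! i \<notin> set (take i xs)) [0..<length xs]"

(* The state (C_1, n_1, ..., C_k, n_k) is the list [(C_1, n_1), ..., (C_k, n_k)].  The first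
   appearance i of a type is paired with the next first appearance j, or with the length of
   the list in the case of the last type. *)
definition aggregate :: "'c list \<Rightarrow> ('c \<times> nat) list" where
  "aggregate xs =
     map2 (\<lambda>i j. (xs ! i, j - i - 1)) (first_appearances xs)
       (tl (first_appearances xs) @ [length xs])"

definition Y_state :: "('s \<times> 'c) set \<Rightarrow> (int \<Rightarrow> ('c, 's) item) \<Rightarrow> int \<Rightarrow> ('c \<times> nat) list" where
  "Y_state G z N = aggregate (X_state G z N)"

definition Y_states :: "('c \<times> nat) list set" where
  "Y_states = {y. distinct (map fst y)}"

(* Time-homogeneous Markov chain with discrete state space and time set the integers: h i is the
   state prescribed i steps before time N. *)
definition markov_chain :: "'w measure \<Rightarrow> (int \<Rightarrow> 'w \<Rightarrow> 'a) \<Rightarrow> ('a \<Rightarrow> 'a pmf) \<Rightarrow> bool" where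
  "markov_chain M Y K \<longleftrightarrow>
     (\<forall>N. Y N \<in> measurable M (count_space UNIV)) \<and>
     (\<forall>N n h y.
        measure M {\<omega> \<in> space M. (\<forall>i\<le>n. Y (N - int i) \<omega> = h i) \<and> Y (N + 1) \<omega> = y} =
        measure M {\<omega> \<in> space M. \<forall>i\<le>n. Y (N - int i) \<omega> = h i} * pmf (K (h 0)) y)"

definition stationary_distribution :: "('a \<Rightarrow> 'a pmf) \<Rightarrow> 'a pmf \<Rightarrow> bool" where
  "stationary_distribution K p \<longleftrightarrow> bind_pmf p K = p"

end

theory Submission
  imports Defs
begin

text \<open>
  The list \<open>X\<close> of waiting types has a stationary law of product form, proportional to the product of
  \<open>lam (x ! i) / capacity (set of the first i + 1 types)\<close>; the balance equations reduce to an
  identity for the insertions of a served type. Reversed in time, the transitions out of a list depend,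
  after aggregation, only on its aggregate, so the reversed chain is strongly lumpable and the
  aggregated chain is Markov with the pushed-forward stationary law. Summing geometric series over the
  multiplicities gives the normalizing constant.

  For the two-sided sequence, the system started empty at time \<open>T\<close> is monotone in \<open>T\<close>, and at
  any fixed time it is empty with probability at least \<open>\<pi> []\<close>, uniformly in \<open>T\<close>. Hence with probability
  at least \<open>\<pi> []\<close> a given epoch is empty for all earlier starts; the zero-one law yields infinitely many
  such epochs in the past, and stationarity transfers this to the future. Between these epochs the
  matching is determined by finite runs, which gives existence and uniqueness.
\<close>

text \<open>Time has to be reversed because the aggregate does not determine its own forward
  transitions: when a good takes the first agent of a type, the new state depends on where that type
  recurs, and the counts hide this. Backwards, a service is the insertion of an agent ahead of whom
  nobody is compatible with the good. What such an insertion does to the aggregate, and the factor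
  by which it multiplies the stationary weight, depend only on the positions of first appearances
  and the type sets of prefixes.

  Two further circumstances shape the proof. The probability vectors may have zero entries, so
  weights may vanish: ratios are stated in cross-multiplied form, and the aggregated kernel needs a
  convention at states of probability zero. And the process of the statement rests on a definite
  description that is meaningful only almost surely; the computations are therefore done with an
  everywhere measurable queue and carried over to the completed measure.\<close>

lemma UNIV_item: "(UNIV :: ('c, 's) item set) = range Agent \<union> range Good"
proof -
  have "i \<in> range Agent \<union> range Good" for i :: "('c, 's) item"
    by (cases i) auto
  then show ?thesis by blast
qed

instance item :: (finite, finite) finite
  by standard (simp add: UNIV_item)

lemma sum_item:
  fixes f :: "('c::finite, 's::finite) item \<Rightarrow> 'a::comm_monoid_add"
  shows "(\<Sum>i\<in>UNIV. f i) = (\<Sum>c\<in>UNIV. f (Agent c)) + (\<Sum>s\<in>UNIV. f (Good s))"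
  unfolding UNIV_item
  by (subst sum.union_disjoint) (auto simp: sum.reindex inj_on_def)

subsection \<open>Queues\<close>

fun remove_first :: "('a \<Rightarrow> bool) \<Rightarrow> 'a list \<Rightarrow> 'a list" where
  "remove_first P [] = []"
| "remove_first P (x # xs) = (if P x then xs else x # remove_first P xs)"

definition insert_at :: "nat \<Rightarrow> 'a \<Rightarrow> 'a list \<Rightarrow> 'a list" where
  "insert_at j c x = take j x @ c # drop j x"

text \<open>Service read backwards: the pairs (position, type) whose insertion into \<open>x\<close>
  gives a list from which a good with compatibility \<open>P\<close> takes exactly the inserted
  agent.\<close>

definition insertions :: "('a \<Rightarrow> bool) \<Rightarrow> 'a list \<Rightarrow> (nat \<times> 'a) set" where
  "insertions P x = {(j, c). j \<le> length x \<and> P c \<and> (\<forall>d\<in>set (take j x). \<not> P d)}"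

lemma remove_first_id: "(\<forall>d\<in>set x. \<not> P d) \<Longrightarrow> remove_first P x = x"
  by (induction x) auto

lemma remove_first_append: "(\<forall>d\<in>set u. \<not> P d) \<Longrightarrow> remove_first P (u @ v) = u @ remove_first P v"
  by (induction u) auto

lemma map_remove_first: "map f (remove_first (\<lambda>m. P (f m)) q) = remove_first P (map f q)"
  by (induction q) auto

lemma remove_first_insert_at:
  assumes "(j, c) \<in> insertions P x"
  shows "remove_first P (insert_at j c x) = x"
  using assms by (simp add: insert_at_def insertions_def remove_first_append)

text \<open>The two parts are an effective service and a lost good. They are disjoint, since an
  insertion lengthens the list.\<close>

lemma remove_first_eq:
  "{x. remove_first P x = x'} =
     (\<lambda>(j, c). insert_at j c x') ` insertions P x' \<union> (if \<forall>d\<in>set x'. \<not> P d then {x'} else {})"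
proof (intro equalityI subsetI)
  fix x assume "x \<in> {x. remove_first P x = x'}"
  then have x': "x' = remove_first P x" by simp
  show "x \<in> (\<lambda>(j, c). insert_at j c x') ` insertions P x' \<union> (if \<forall>d\<in>set x'. \<not> P d then {x'} else {})"
  proof (cases "\<exists>d\<in>set x. P d")
    case True
    then obtain u c v where x: "x = u @ c # v" "P c" "\<forall>d\<in>set u. \<not> P d"
      using split_list_first_prop by metis
    then have "x' = u @ v" by (simp add: x' remove_first_append)
    then have "(length u, c) \<in> insertions P x'" "x = insert_at (length u) c x'"
      using x by (auto simp: insertions_def insert_at_def)
    then show ?thesis by force
  next
    case False
    then show ?thesis using x' by (auto simp: remove_first_id)
  qed
next
  fix x assume "x \<in> (\<lambda>(j, c). insert_at j c x') ` insertions P x' \<union> (if \<forall>d\<in>set x'. \<not> P d then {x'} else {})"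
  then show "x \<in> {x. remove_first P x = x'}"
    by (auto simp: remove_first_insert_at remove_first_id split: if_splits)
qed

text \<open>The pair is recovered from the result: \<open>j\<close> is the length of the longest
  prefix without \<open>P\<close>-elements, and \<open>c\<close> is the entry right after
  it.\<close>

lemma inj_on_insert_at: "inj_on (\<lambda>(j, c). insert_at j c x) (insertions P x)"
proof -
  have "length (takeWhile (\<lambda>d. \<not> P d) (insert_at j c x)) = j"
    if "(j, c) \<in> insertions P x" for j c
    using that by (simp add: insertions_def insert_at_def takeWhile_append)
  moreover have "insert_at j c x ! j = c" if "(j, c) \<in> insertions P x" for j c
    using that by (simp add: insertions_def insert_at_def nth_append)
  ultimately show ?thesis
    unfolding inj_on_def by (metis (no_types, lifting) case_prod_conv surj_pair)
qed

lemma finite_insertions [simp]: "finite (insertions P (x :: 'a::finite list))"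
  by (rule finite_subset[of _ "{..length x} \<times> UNIV"]) (auto simp: insertions_def)

lemma set_insert_at: "set (insert_at j c x) = insert c (set x)"
  by (metis append_take_drop_id insert_at_def list.simps(15) set_append Un_insert_right)

lemma length_insert_at [simp]: "length (insert_at j c x) = Suc (length x)"
  by (simp add: insert_at_def)

lemma insert_at_snoc:
  "j \<le> length x \<Longrightarrow> insert_at j c (x @ [d]) = insert_at j c x @ [d]"
  "insert_at (Suc (length x)) c (x @ [d]) = x @ [d, c]"
  by (simp_all add: insert_at_def)

lemma insert_at_neq: "insert_at j c x \<noteq> x"
  by (metis length_insert_at n_not_Suc_n)

definition step :: "('s \<times> 'c) set \<Rightarrow> ('c, 's) item \<Rightarrow> 'c list \<Rightarrow> 'c list" where
  "step G i x = (case i of Agent c \<Rightarrow> x @ [c] | Good s \<Rightarrow> remove_first (\<lambda>c. (s, c) \<in> G) x)"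

lemma step_simps [simp]:
  "step G (Agent c) x = x @ [c]"
  "step G (Good s) x = remove_first (\<lambda>c. (s, c) \<in> G) x"
  by (simp_all add: step_def)

subsection \<open>Aggregation\<close>

text \<open>Effect of appending an agent of a type already present. On the empty list the value
  comes from \<open>last []\<close> and means nothing, hence the guards \<open>y \<noteq> []\<close>
  below.\<close>

definition add_last :: "('c \<times> nat) list \<Rightarrow> ('c \<times> nat) list" where
  "add_last y = butlast y @ [(fst (last y), Suc (snd (last y)))]"

lemma add_last_snoc [simp]: "add_last (y @ [(c, n)]) = y @ [(c, Suc n)]"
  by (simp add: add_last_def)

lemma add_last_neq_Nil [simp]: "add_last y \<noteq> []"
  by (simp add: add_last_def)

lemma aggregate_Nil [simp]: "aggregate [] = []"
  by (simp add: aggregate_def first_appearances_def)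

lemma first_appearances_snoc:
  "first_appearances (x @ [d]) = first_appearances x @ (if d \<in> set x then [] else [length x])"
  unfolding first_appearances_def by (auto simp: nth_append intro!: filter_cong)

lemma set_first_appearances: "set (first_appearances x) \<subseteq> {..<length x}"
  by (auto simp: first_appearances_def)

lemma first_appearances_eq_Nil [simp]: "first_appearances x = [] \<longleftrightarrow> x = []"
  by (induction x rule: rev_induct) (auto simp: first_appearances_snoc, simp add: first_appearances_def)

lemma zip_snoc_tl: "zip (u @ [l]) (tl (u @ [l]) @ [a]) = zip u (tl (u @ [l])) @ [(l, a)]"
  by (subst zip_append) auto

text \<open>This recursion at the right end replaces the definition by indices from here on:
  arrivals append, and both weights factor along prefixes. Only the last gap changes, being the one
  closed off by the length of the list.\<close>

lemma aggregate_snoc: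
  "aggregate (x @ [d]) = (if d \<in> set x then add_last (aggregate x) else aggregate x @ [(d, 0)])"
proof (cases "x = []")
  case True
  then show ?thesis by (simp add: aggregate_def first_appearances_snoc) (simp add: first_appearances_def)
next
  case False
  define u where "u = butlast (first_appearances x)"
  define l where "l = last (first_appearances x)"
  have f: "first_appearances x = u @ [l]"
    using False by (simp add: u_def l_def)
  have less: "l < length x" "\<And>i. i \<in> set u \<Longrightarrow> i < length x"
    using set_first_appearances[of x] f by auto
  let ?g = "\<lambda>x. \<lambda>(i, j). (x ! i, j - i - 1)"
  have g: "map (?g (x @ [d])) (zip u v) = map (?g x) (zip u v)" for v
    using less by (auto simp: nth_append dest: set_zip_leftD)
  have agg: "aggregate x = map (?g x) (zip u (tl (u @ [l]))) @ [(x ! l, length x - l - 1)]"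
    unfolding aggregate_def f zip_snoc_tl by simp
  show ?thesis
  proof (cases "d \<in> set x")
    case True
    have "aggregate (x @ [d]) =
        map (?g (x @ [d])) (zip u (tl (u @ [l]))) @ [((x @ [d]) ! l, Suc (length x) - l - 1)]"
      unfolding aggregate_def first_appearances_snoc f using True by (simp add: zip_snoc_tl)
    also have "\<dots> = map (?g x) (zip u (tl (u @ [l]))) @ [(x ! l, Suc (length x - l - 1))]"
      unfolding g using less by (simp add: nth_append Suc_diff_Suc)
    finally show ?thesis using True by (simp add: agg)
  next
    case new: False
    have tl: "tl ((u @ [l]) @ [length x]) = tl (u @ [l]) @ [length x]"
      by (subst tl_append2) auto
    have "aggregate (x @ [d]) = map (?g (x @ [d])) (zip ((u @ [l]) @ [length x])
          (tl ((u @ [l]) @ [length x]) @ [Suc (length x)]))"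
      unfolding aggregate_def first_appearances_snoc f using new by simp
    also have "\<dots> = map (?g (x @ [d])) (zip u (tl (u @ [l]))) @
        [((x @ [d]) ! l, length x - l - 1), (d, 0)]"
      unfolding zip_snoc_tl unfolding tl zip_snoc_tl by simp
    also have "\<dots> = map (?g x) (zip u (tl (u @ [l]))) @ [(x ! l, length x - l - 1), (d, 0)]"
      unfolding g using less by (simp add: nth_append)
    finally show ?thesis using new by (simp add: agg)
  qed
qed

lemma aggregate_eq_Nil [simp]: "aggregate x = [] \<longleftrightarrow> x = []"
  by (induction x rule: rev_induct) (auto simp: aggregate_snoc)

lemma map_fst_add_last: "y \<noteq> [] \<Longrightarrow> map fst (add_last y) = map fst y"
  by (cases y rule: rev_cases) auto

lemma fst_set_add_last: "y \<noteq> [] \<Longrightarrow> fst ` set (add_last y) = fst ` set y"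
  by (metis list.set_map map_fst_add_last)

lemma fst_set_aggregate [simp]: "fst ` set (aggregate x) = set x"
proof (induction x rule: rev_induct)
  case (snoc d x)
  show ?case
  proof (cases "d \<in> set x")
    case True
    then have "aggregate x \<noteq> []" by auto
    then show ?thesis using snoc True by (simp add: aggregate_snoc fst_set_add_last insert_absorb)
  qed (use snoc in \<open>simp add: aggregate_snoc\<close>)
qed simp

lemma distinct_aggregate: "distinct (map fst (aggregate x))"
proof (induction x rule: rev_induct)
  case (snoc d x)
  show ?case
  proof (cases "d \<in> set x")
    case True
    then have "aggregate x \<noteq> []" by auto
    then show ?thesis using snoc True by (simp add: aggregate_snoc map_fst_add_last)
  next
    case False
    then show ?thesis using snoc fst_set_aggregate[of x] by (simp add: aggregate_snoc)
  qed
qed simp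

lemma aggregate_in_Y_states: "aggregate x \<in> Y_states"
  by (simp add: Y_states_def distinct_aggregate)

text \<open>The aggregate determines the length, so its fibres are finite and the sums over them
  below are finite sums.\<close>

lemma length_aggregate: "(\<Sum>(c, n)\<leftarrow>aggregate x. Suc n) = length x"
proof (induction x rule: rev_induct)
  case (snoc d x)
  show ?case
  proof (cases "d \<in> set x")
    case True
    then have "aggregate x \<noteq> []" by auto
    then obtain y c n where "aggregate x = y @ [(c, n)]" by (metis rev_exhaust surj_pair)
    then show ?thesis using snoc True by (simp add: aggregate_snoc)
  qed (use snoc in \<open>simp add: aggregate_snoc\<close>)
qed simp

lemma finite_aggregate_vimage [simp]: "finite {x :: 'c::finite list. aggregate x = y}"
proof (rule finite_subset)
  show "{x. aggregate x = y} \<subseteq> {x :: 'c list. set x \<subseteq> UNIV \<and> length x = (\<Sum>(c, n)\<leftarrow>y. Suc n)}"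
    by (clarsimp simp only: length_aggregate mem_Collect_eq subset_UNIV simp_thms)
qed (rule finite_lists_length_eq, simp)

lemma add_last_inj: "y \<noteq> [] \<Longrightarrow> y' \<noteq> [] \<Longrightarrow> add_last y = add_last y' \<longleftrightarrow> y = y'"
  by (cases y rule: rev_cases; cases y' rule: rev_cases) auto

lemma add_last_neq_new: "add_last y \<noteq> y' @ [(d, 0)]"
  by (simp add: add_last_def)

text \<open>Lists with equal aggregates grow in parallel: at a first appearance both receive the
  same new type, elsewhere each receives any type already present. Facts that are constant on fibres
  of \<open>aggregate\<close> are proved by this induction.\<close>

lemma aggregate_eq_induct [consumes 1, case_names Nil new old]:
  assumes "aggregate x = aggregate x'"
    and "P [] []"
    and "\<And>x x' d. \<lbrakk>aggregate x = aggregate x'; set x = set x'; length x = length x'; P x x'; d \<notin> set x\<rbrakk> \<Longrightarrow> P (x @ [d]) (x' @ [d])"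
    and "\<And>x x' d d'. \<lbrakk>aggregate x = aggregate x'; set x = set x'; length x = length x'; P x x'; d \<in> set x; d' \<in> set x\<rbrakk> \<Longrightarrow> P (x @ [d]) (x' @ [d'])"
  shows "P x x'"
  using assms(1)
proof (induction x arbitrary: x' rule: rev_induct)
  case Nil
  then have "x' = []" by (metis aggregate_Nil aggregate_eq_Nil)
  then show ?case using assms(2) by simp
next
  case (snoc d x)
  then have "x' \<noteq> []" by (metis aggregate_eq_Nil snoc_eq_iff_butlast)
  then obtain v d' where x': "x' = v @ [d']" by (metis rev_exhaust)
  have nonempty: "aggregate u \<noteq> []" if "e \<in> set u" for e and u :: "'a list"
    using that by auto
  have agg: "aggregate x = aggregate v \<and> (d \<in> set x \<longleftrightarrow> d' \<in> set v) \<and> (d \<in> set x \<or> d = d')"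
  proof (cases "d \<in> set x"; cases "d' \<in> set v")
    assume "d \<in> set x" "d' \<in> set v"
    then show ?thesis using snoc.prems add_last_inj[OF nonempty nonempty]
      by (simp add: x' aggregate_snoc)
  next
    assume "d \<in> set x" "d' \<notin> set v"
    then show ?thesis using snoc.prems by (simp add: x' aggregate_snoc add_last_neq_new)
  next
    assume "d \<notin> set x" "d' \<in> set v"
    then show ?thesis using snoc.prems by (simp add: x' aggregate_snoc add_last_neq_new[symmetric])
  next
    assume "d \<notin> set x" "d' \<notin> set v"
    then show ?thesis using snoc.prems by (simp add: x' aggregate_snoc)
  qed
  then have agg1: "aggregate x = aggregate v" by blast
  have sets: "set x = set v"
    using arg_cong[OF agg1, of "\<lambda>y. fst ` set y"] by simp
  have lengths: "length x = length v"
    using arg_cong[OF agg1, of "\<lambda>y. \<Sum>(c, n)\<leftarrow>y. Suc n"] by (simp only: length_aggregate)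
  have IH: "P x v" using snoc.IH agg1 .
  show ?case
  proof (cases "d \<in> set x")
    case True
    then show ?thesis unfolding x' using agg agg1 sets lengths IH by (intro assms(4)) auto
  next
    case False
    then show ?thesis unfolding x' using agg agg1 sets lengths IH assms(3)[of x v d] by auto
  qed
qed

lemma take_aggregate_eq:
  assumes "aggregate x = aggregate x'"
  shows "aggregate (take j x) = aggregate (take j x')"
  using assms by (induction rule: aggregate_eq_induct) (auto simp: aggregate_snoc take_Cons' split: if_splits)

text \<open>An aggregate fixes the positions of first appearances, hence the type set of every
  prefix. Inserting \<open>c\<close> at \<open>j\<close> creates its first appearance or moves it
  forward, and this is the same operation on the whole fibre. Removal has no such property: it
  uncovers the next occurrence of the type.\<close>

lemma aggregate_insert_at:
  assumes "aggregate x = aggregate x'" "j \<le> length x" "c \<notin> set (take j x)"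
  shows "aggregate (insert_at j c x) = aggregate (insert_at j c x')"
  using assms
proof (induction rule: aggregate_eq_induct)
  case Nil
  show ?case by simp
next
  case (new x x' d)
  show ?case
  proof (cases "j = Suc (length x)")
    case True
    have "insert_at j c (x @ [d]) = (x @ [d]) @ [c]" "insert_at j c (x' @ [d]) = (x' @ [d]) @ [c]"
      using True new.hyps(3) by (simp_all add: insert_at_def)
    moreover have "aggregate (x @ [d]) = aggregate (x' @ [d])"
      using new.hyps by (simp only: aggregate_snoc)
    moreover have "set (x @ [d]) = set (x' @ [d])" using new.hyps(2) by simp
    ultimately show ?thesis by (simp only: aggregate_snoc)
  next
    case False
    then have j: "j \<le> length x" using new.prems by simp
    then have "aggregate (insert_at j c x) = aggregate (insert_at j c x')"
      using new.prems new.IH by simp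
    moreover have "insert_at j c (x @ [d]) = insert_at j c x @ [d]" "insert_at j c (x' @ [d]) = insert_at j c x' @ [d]"
      using j new.hyps(3) by (simp_all only: insert_at_snoc(1))
    moreover have "set (insert_at j c x) = set (insert_at j c x')"
      using new.hyps(2) by (simp only: set_insert_at)
    ultimately show ?thesis by (simp only: aggregate_snoc)
  qed
next
  case (old x x' d d')
  have "d \<in> set x" "d' \<in> set x'" using old.hyps by simp_all
  show ?case
  proof (cases "j = Suc (length x)")
    case True
    have "insert_at j c (x @ [d]) = (x @ [d]) @ [c]" "insert_at j c (x' @ [d']) = (x' @ [d']) @ [c]"
      using True old.hyps(3) by (simp_all add: insert_at_def)
    moreover have "aggregate (x @ [d]) = aggregate (x' @ [d'])"
      using old.hyps(1) \<open>d \<in> set x\<close> \<open>d' \<in> set x'\<close> by (simp only: aggregate_snoc simp_thms if_True)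
    moreover have "set (x @ [d]) = set (x' @ [d'])" using old.hyps by auto
    ultimately show ?thesis by (simp only: aggregate_snoc)
  next
    case False
    then have j: "j \<le> length x" using old.prems by simp
    then have "aggregate (insert_at j c x) = aggregate (insert_at j c x')"
      using old.prems old.IH by simp
    moreover have "insert_at j c (x @ [d]) = insert_at j c x @ [d]" "insert_at j c (x' @ [d']) = insert_at j c x' @ [d']"
      using j old.hyps(3) by (simp_all only: insert_at_snoc(1))
    moreover have "d \<in> set (insert_at j c x)" "d' \<in> set (insert_at j c x')"
      using old.hyps by (simp_all add: set_insert_at)
    ultimately show ?thesis by (simp only: aggregate_snoc simp_thms if_True)
  qed
qed

section \<open>Product-form weights of queues and aggregates\<close>

locale matching_rates =
  fixes G :: "('s::finite \<times> 'c::finite) set" and lam :: "'c \<Rightarrow> real" and mu :: "'s \<Rightarrow> real"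
  assumes lam_nonneg: "lam c \<ge> 0" and mu_nonneg: "mu s \<ge> 0"
    and stability: "C \<noteq> {} \<Longrightarrow> sum lam C < sum mu (compatible_goods G C)"
begin

definition capacity :: "'c set \<Rightarrow> real" where
  "capacity C = sum mu (compatible_goods G C)"

text \<open>The product form of an order-independent queue: the denominator is the total rate at
  which the first \<open>i + 1\<close> agents are served, which depends only on their set of
  types.\<close>

definition weight :: "'c list \<Rightarrow> real" where
  "weight x = (\<Prod>i<length x. lam (x ! i) / capacity (set (take (Suc i) x)))"

definition aggregate_weight :: "('c \<times> nat) list \<Rightarrow> real" where
  "aggregate_weight y = (\<Prod>l<length y. lam (fst (y ! l)) / capacity (fst ` set (take (Suc l) y)) *
     (sum lam (fst ` set (take (Suc l) y)) / capacity (fst ` set (take (Suc l) y))) ^ snd (y ! l))"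

definition total_rate :: real where
  "total_rate = sum lam UNIV + sum mu UNIV"

lemma load_less_capacity: "C \<noteq> {} \<Longrightarrow> sum lam C < capacity C"
  by (simp add: stability capacity_def)

text \<open>Strictness of the stability condition gives this even if all types in \<open>C\<close>
  have arrival rate zero. So weights may vanish, but their denominators do not.\<close>

lemma capacity_pos: "C \<noteq> {} \<Longrightarrow> capacity C > 0"
  using load_less_capacity[of C] sum_nonneg[of C lam] lam_nonneg by force

lemma capacity_empty [simp]: "capacity {} = 0"
  by (simp add: capacity_def compatible_goods_def)

lemma capacity_nonneg: "capacity C \<ge> 0"
  by (simp add: capacity_def sum_nonneg mu_nonneg)

lemma capacity_insert_pos [simp]: "capacity (insert c C) > 0" "capacity (insert c C) \<noteq> 0"
  using capacity_pos[of "insert c C"] by auto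

lemma total_rate_pos: "total_rate > 0"
proof -
  have "sum lam UNIV < sum mu UNIV"
    using stability[of UNIV] sum_mono2[of UNIV "compatible_goods G UNIV" mu] mu_nonneg by force
  then show ?thesis
    using sum_nonneg[of UNIV lam] lam_nonneg unfolding total_rate_def by (metis add_nonneg_pos order_le_less_trans)
qed

lemma weight_Nil [simp]: "weight [] = 1"
  by (simp add: weight_def)

lemma weight_snoc: "weight (x @ [d]) = weight x * (lam d / capacity (insert d (set x)))"
proof -
  have "(\<Prod>i<length x. lam ((x @ [d]) ! i) / capacity (set (take (Suc i) (x @ [d])))) =
        (\<Prod>i<length x. lam (x ! i) / capacity (set (take (Suc i) x)))"
    by (rule prod.cong) (auto simp: nth_append)
  then show ?thesis by (simp add: weight_def nth_append)
qed

lemma weight_nonneg: "weight x \<ge> 0"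
  by (simp add: weight_def prod_nonneg lam_nonneg capacity_nonneg)

lemma aggregate_weight_Nil [simp]: "aggregate_weight [] = 1"
  by (simp add: aggregate_weight_def)

lemma aggregate_weight_snoc:
  "aggregate_weight (y @ [(c, n)]) = aggregate_weight y *
     (lam c / capacity (insert c (fst ` set y)) *
      (sum lam (insert c (fst ` set y)) / capacity (insert c (fst ` set y))) ^ n)"
proof -
  have "(\<Prod>l<length y. lam (fst ((y @ [(c, n)]) ! l)) / capacity (fst ` set (take (Suc l) (y @ [(c, n)]))) *
     (sum lam (fst ` set (take (Suc l) (y @ [(c, n)]))) / capacity (fst ` set (take (Suc l) (y @ [(c, n)])))) ^ snd ((y @ [(c, n)]) ! l))
    = aggregate_weight y"
    unfolding aggregate_weight_def by (rule prod.cong) (auto simp: nth_append)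
  then show ?thesis by (simp add: aggregate_weight_def[of "y @ [(c, n)]"] nth_append)
qed

lemma aggregate_weight_add_last:
  assumes "y \<noteq> []"
  shows "aggregate_weight (add_last y) =
    aggregate_weight y * (sum lam (fst ` set y) / capacity (fst ` set y))"
proof -
  obtain u c n where "y = u @ [(c, n)]" using assms by (metis rev_exhaust surj_pair)
  then show ?thesis by (simp add: aggregate_weight_snoc)
qed

subsection \<open>Partial balance\<close>

text \<open>The left side is the rate at which an agent of type \<open>c\<close> is served when the
  types ahead of it form \<open>C\<close>.\<close>

lemma marginal_capacity:
  "(\<Sum>s | (s, c) \<in> G \<and> (\<forall>d\<in>C. (s, d) \<notin> G). mu s) = capacity (insert c C) - capacity C"
proof -
  have "compatible_goods G (insert c C) =
      {s. (s, c) \<in> G \<and> (\<forall>d\<in>C. (s, d) \<notin> G)} \<union> compatible_goods G C"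
    by (auto simp: compatible_goods_def)
  then have "capacity (insert c C) = (\<Sum>s | (s, c) \<in> G \<and> (\<forall>d\<in>C. (s, d) \<notin> G). mu s) + capacity C"
    unfolding capacity_def
    by (simp only:) (rule sum.union_disjoint, auto simp: compatible_goods_def)
  then show ?thesis by simp
qed

text \<open>Partial balance for one type: flow into \<open>x\<close> by departures of type
  \<open>c\<close> equals flow out of \<open>x\<close> by arrivals of type \<open>c\<close>. When
  \<open>d\<close> is appended, with \<open>D\<close> the new type set, the old insertions keep the
  fraction \<open>capacity D / capacity (insert c D)\<close> of the total, and the insertion at the
  very end contributes the remaining fraction.\<close>

lemma weight_insertions:
  "(\<Sum>j\<le>length x. weight (insert_at j c x) * (capacity (insert c (set (take j x))) - capacity (set (take j x))))
     = weight x * lam c"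
proof (induction x rule: rev_induct)
  case Nil
  then show ?case using weight_snoc[of "[]" c] by (simp add: insert_at_def)
next
  case (snoc d x)
  let ?m = "\<lambda>j. capacity (insert c (set (take j x))) - capacity (set (take j x))"
  let ?D = "insert d (set x)"
  have "(\<Sum>j\<le>length x. weight (insert_at j c (x @ [d])) *
          (capacity (insert c (set (take j (x @ [d])))) - capacity (set (take j (x @ [d]))))) =
        (\<Sum>j\<le>length x. weight (insert_at j c x) * ?m j) * (lam d / capacity (insert c ?D))"
    unfolding sum_distrib_right
    by (rule sum.cong) (auto simp: insert_at_snoc(1) weight_snoc set_insert_at insert_commute)
  also have "\<dots> = weight (x @ [d]) * lam c * (capacity ?D / capacity (insert c ?D))"
    by (simp add: snoc.IH weight_snoc)
  finally have "(\<Sum>j\<le>length (x @ [d]). weight (insert_at j c (x @ [d])) *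
          (capacity (insert c (set (take j (x @ [d])))) - capacity (set (take j (x @ [d]))))) =
     weight (x @ [d]) * lam c * (capacity ?D / capacity (insert c ?D)) +
     weight ((x @ [d]) @ [c]) * (capacity (insert c ?D) - capacity ?D)"
    by (simp add: insert_at_snoc(2))
  also have "\<dots> = weight (x @ [d]) * lam c"
    unfolding weight_snoc[of "x @ [d]"] by (simp add: field_simps)
  finally show ?case .
qed

text \<open>Summing over goods last collects, for each position and type, exactly the goods that
  would serve the inserted agent. Their rates form a difference of capacities, and the partial
  balances add up over the types.\<close>

lemma service_balance:
  "(\<Sum>s\<in>UNIV. mu s * (\<Sum>(j, c)\<in>insertions (\<lambda>c. (s, c) \<in> G) x. weight (insert_at j c x)))
     = weight x * sum lam UNIV"
proof -
  have "(\<Sum>(j, c)\<in>insertions (\<lambda>c. (s, c) \<in> G) x. weight (insert_at j c x)) =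
    (\<Sum>c\<in>UNIV. \<Sum>j\<le>length x. if (s, c) \<in> G \<and> (\<forall>d\<in>set (take j x). (s, d) \<notin> G)
        then weight (insert_at j c x) else 0)" (is "?l s = ?r s") for s
  proof -
    have "?l s = (\<Sum>(j, c)\<in>{..length x} \<times> UNIV. if (s, c) \<in> G \<and> (\<forall>d\<in>set (take j x). (s, d) \<notin> G)
        then weight (insert_at j c x) else 0)"
      by (rule sum.mono_neutral_cong_left) (auto simp: insertions_def split: if_splits)
    also have "\<dots> = ?r s"
      by (subst sum.cartesian_product[symmetric], rule sum.swap)
    finally show ?thesis .
  qed
  then have "(\<Sum>s\<in>UNIV. mu s * (\<Sum>(j, c)\<in>insertions (\<lambda>c. (s, c) \<in> G) x. weight (insert_at j c x))) =
    (\<Sum>s\<in>UNIV. \<Sum>c\<in>UNIV. \<Sum>j\<le>length x. mu s * (if (s, c) \<in> G \<and> (\<forall>d\<in>set (take j x). (s, d) \<notin> G)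
        then weight (insert_at j c x) else 0))"
    by (simp add: sum_distrib_left)
  also have "\<dots> = (\<Sum>c\<in>UNIV. \<Sum>s\<in>UNIV. \<Sum>j\<le>length x. mu s * (if (s, c) \<in> G \<and> (\<forall>d\<in>set (take j x). (s, d) \<notin> G)
        then weight (insert_at j c x) else 0))"
    by (rule sum.swap)
  also have "\<dots> = (\<Sum>c\<in>UNIV. \<Sum>j\<le>length x. \<Sum>s\<in>UNIV. mu s * (if (s, c) \<in> G \<and> (\<forall>d\<in>set (take j x). (s, d) \<notin> G)
        then weight (insert_at j c x) else 0))"
    by (intro sum.cong refl sum.swap)
  also have "\<dots> = (\<Sum>c\<in>UNIV. \<Sum>j\<le>length x. weight (insert_at j c x) *
       (capacity (insert c (set (take j x))) - capacity (set (take j x))))"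
  proof (intro sum.cong refl)
    fix c j
    have "(\<Sum>s\<in>UNIV. mu s * (if (s, c) \<in> G \<and> (\<forall>d\<in>set (take j x). (s, d) \<notin> G)
        then weight (insert_at j c x) else 0)) =
      (\<Sum>s | (s, c) \<in> G \<and> (\<forall>d\<in>set (take j x). (s, d) \<notin> G). mu s * weight (insert_at j c x))"
      by (rule sum.mono_neutral_cong_right) auto
    then show "(\<Sum>s\<in>UNIV. mu s * (if (s, c) \<in> G \<and> (\<forall>d\<in>set (take j x). (s, d) \<notin> G)
        then weight (insert_at j c x) else 0)) = weight (insert_at j c x) *
       (capacity (insert c (set (take j x))) - capacity (set (take j x)))"
      by (simp only: sum_distrib_right[symmetric] marginal_capacity mult.commute)
  qed
  also have "\<dots> = weight x * sum lam UNIV"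
    by (simp add: weight_insertions sum_distrib_left)
  finally show ?thesis .
qed

definition rate :: "('c, 's) item \<Rightarrow> real" where
  "rate i = (case i of Agent c \<Rightarrow> lam c | Good s \<Rightarrow> mu s)"

lemma rate_simps [simp]: "rate (Agent c) = lam c" "rate (Good s) = mu s"
  by (simp_all add: rate_def)

lemma rate_nonneg: "rate i \<ge> 0"
  by (cases i) (auto simp: lam_nonneg mu_nonneg)

lemma finite_step_vimage [simp]: "finite {x. step G i x = x'}"
proof (cases i)
  case (Agent c)
  have "{x. x @ [c] = x'} \<subseteq> {butlast x'}" by auto
  then show ?thesis using Agent finite_subset by auto
next
  case (Good s)
  then show ?thesis by (simp add: remove_first_eq)
qed

text \<open>Stationary flow into \<open>x'\<close> from lists with property \<open>A\<close>, up to
  normalization. With \<open>A\<close> always true it enters the balance equations; with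
  \<open>A\<close> a fibre of \<open>aggregate\<close>, division by \<open>weight x'\<close> gives
  the rate of the reversed chain from \<open>x'\<close> into that fibre.\<close>

definition inflow :: "('c list \<Rightarrow> bool) \<Rightarrow> 'c list \<Rightarrow> real" where
  "inflow A x' = (\<Sum>i\<in>UNIV. rate i * (\<Sum>x | step G i x = x' \<and> A x. weight x))"

lemma service_inflow:
  "(\<Sum>x | step G (Good s) x = x' \<and> A x. weight x) =
     (\<Sum>(j, c)\<in>insertions (\<lambda>c. (s, c) \<in> G) x'. if A (insert_at j c x') then weight (insert_at j c x') else 0) +
     (if (\<forall>d\<in>set x'. (s, d) \<notin> G) \<and> A x' then weight x' else 0)"
proof -
  let ?w = "\<lambda>x. if A x then weight x else 0"
  let ?P = "\<lambda>c. (s, c) \<in> G"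
  have "(\<Sum>x | step G (Good s) x = x' \<and> A x. weight x) = (\<Sum>x | step G (Good s) x = x'. ?w x)"
    by (rule sum.mono_neutral_cong_left) (use finite_step_vimage[of "Good s"] in auto)
  also have "\<dots> = (\<Sum>x\<in>(\<lambda>(j, c). insert_at j c x') ` insertions ?P x' \<union> (if \<forall>d\<in>set x'. \<not> ?P d then {x'} else {}). ?w x)"
    by (simp add: remove_first_eq)
  also have "\<dots> = (\<Sum>x\<in>(\<lambda>(j, c). insert_at j c x') ` insertions ?P x'. ?w x) +
      (\<Sum>x\<in>(if \<forall>d\<in>set x'. \<not> ?P d then {x'} else {}). ?w x)"
    by (rule sum.union_disjoint) (auto simp: insert_at_neq insert_at_neq[symmetric] split: if_splits)
  also have "(\<Sum>x\<in>(\<lambda>(j, c). insert_at j c x') ` insertions ?P x'. ?w x) =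
      (\<Sum>(j, c)\<in>insertions ?P x'. ?w (insert_at j c x'))"
    by (subst sum.reindex[OF inj_on_insert_at]) (auto simp: o_def intro!: sum.cong)
  finally show ?thesis by auto
qed

lemma arrival_inflow:
  "(\<Sum>c\<in>UNIV. rate (Agent c) * (\<Sum>x | step G (Agent c) x = x' \<and> A x. weight x)) =
     (if x' \<noteq> [] \<and> A (butlast x') then lam (last x') * weight (butlast x') else 0)"
proof (cases x' rule: rev_cases)
  case (snoc v d)
  have "(\<Sum>x | step G (Agent c) x = x' \<and> A x. weight x) = (if c = d \<and> A v then weight v else 0)" for c
  proof -
    have "{x. step G (Agent c) x = x' \<and> A x} = (if c = d \<and> A v then {v} else {})"
      by (auto simp: snoc)
    then show ?thesis by simp
  qed
  then have "(\<Sum>c\<in>UNIV. rate (Agent c) * (\<Sum>x | step G (Agent c) x = x' \<and> A x. weight x)) =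
    (\<Sum>c\<in>UNIV. if c = d then (if A v then lam d * weight v else 0) else 0)"
    by (intro sum.cong) auto
  then show ?thesis by (simp add: snoc)
qed simp

text \<open>The three terms are an arrival, an effective service and a lost good.\<close>

lemma inflow_eq:
  "inflow A x' =
     (if x' \<noteq> [] \<and> A (butlast x') then lam (last x') * weight (butlast x') else 0) +
     (\<Sum>s\<in>UNIV. mu s * (\<Sum>(j, c)\<in>insertions (\<lambda>c. (s, c) \<in> G) x'.
        if A (insert_at j c x') then weight (insert_at j c x') else 0)) +
     (\<Sum>s\<in>UNIV. mu s * (if (\<forall>d\<in>set x'. (s, d) \<notin> G) \<and> A x' then weight x' else 0))"
  unfolding inflow_def sum_item arrival_inflow service_inflow
  by (simp add: sum.distrib distrib_left)

text \<open>Per unit of weight, the arrival term is the last denominator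
  \<open>capacity (set x)\<close>, the lost goods contribute
  \<open>sum mu UNIV - capacity (set x)\<close>, and the services contribute
  \<open>sum lam UNIV\<close>. The empty list fits in because its capacity is 0.\<close>

lemma global_balance: "inflow (\<lambda>_. True) x = total_rate * weight x"
proof -
  have "(if x \<noteq> [] then lam (last x) * weight (butlast x) else 0) = weight x * capacity (set x)"
    by (cases x rule: rev_cases) (auto simp: weight_snoc)
  moreover have "(\<Sum>s\<in>UNIV. mu s * (if \<forall>d\<in>set x. (s, d) \<notin> G then weight x else 0)) =
      weight x * (sum mu UNIV - capacity (set x))"
  proof -
    have "(\<Sum>s\<in>UNIV. mu s * (if \<forall>d\<in>set x. (s, d) \<notin> G then weight x else 0)) =
      (\<Sum>s\<in>UNIV - compatible_goods G (set x). mu s * weight x)"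
      by (rule sum.mono_neutral_cong_right) (auto simp: compatible_goods_def)
    also have "\<dots> = weight x * (sum mu UNIV - capacity (set x))"
      by (simp add: sum_distrib_right[symmetric] capacity_def sum_diff)
    finally show ?thesis .
  qed
  ultimately show ?thesis
    by (simp add: inflow_eq service_balance total_rate_def algebra_simps)
qed

subsection \<open>Lumpability of the reversed chain\<close>

text \<open>The ratio of the weights after and before an insertion involves only
  \<open>lam c\<close> and type sets of prefixes, which are constant on a fibre. It is
  cross-multiplied because weights may be zero.\<close>

lemma weight_insert_at_cong:
  assumes "aggregate x = aggregate x'" "j \<le> length x"
  shows "weight (insert_at j c x) * weight x' = weight (insert_at j c x') * weight x"
proof -
  \<comment> \<open>Covers both induction cases: it only matters that the two lists have equal type
    sets before and after appending.\<close>
  have snoc: "weight (insert_at j c (x @ [d])) * weight (x' @ [d']) =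
      weight (insert_at j c (x' @ [d'])) * weight (x @ [d])"
    if "set x = set x'" "length x = length x'" "set (x @ [d]) = set (x' @ [d'])"
      "j \<le> length x \<Longrightarrow> weight (insert_at j c x) * weight x' = weight (insert_at j c x') * weight x"
      "j \<le> length (x @ [d])" for x x' d d'
  proof (cases "j = Suc (length x)")
    case True
    have "insert_at j c (x @ [d]) = (x @ [d]) @ [c]" "insert_at j c (x' @ [d']) = (x' @ [d']) @ [c]"
      using True that(2) by (simp_all add: insert_at_def)
    then show ?thesis using that(3) by (simp only: weight_snoc[of "x @ [d]"] weight_snoc[of "x' @ [d']"] mult_ac)
  next
    case False
    then have j: "j \<le> length x" using that by simp
    then have ins: "insert_at j c (x @ [d]) = insert_at j c x @ [d]" "insert_at j c (x' @ [d']) = insert_at j c x' @ [d']"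
      using that(2) by (simp_all only: insert_at_snoc(1))
    have eq: "insert d (insert c (set x)) = insert d' (insert c (set x'))" "insert d (set x) = insert d' (set x')"
      using that(3) by auto
    show ?thesis
      unfolding ins weight_snoc set_insert_at eq using that(4)[OF j] by (simp add: field_simps)
  qed
  show ?thesis
    using assms
  proof (induction rule: aggregate_eq_induct)
    case (new x x' d)
    show ?case by (rule snoc) (use new in auto)
  next
    case (old x x' d d')
    show ?case by (rule snoc) (use old in auto)
  qed simp
qed

text \<open>Lumpability of the reversed chain in division-free form, term by term. In the arrival
  term the type of the last agent cancels, because \<open>lam d * weight v\<close> is
  \<open>weight (v @ [d])\<close> times a capacity.\<close>

lemma inflow_cong:
  assumes agg: "aggregate x = aggregate x'"
  shows "inflow (\<lambda>x. aggregate x = y) x * weight x' = inflow (\<lambda>x. aggregate x = y) x' * weight x"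
proof -
  have sets: "set x = set x'"
    using arg_cong[OF agg, of "\<lambda>y. fst ` set y"] by simp
  have lengths: "length x = length x'"
    using arg_cong[OF agg, of "\<lambda>y. \<Sum>(c, n)\<leftarrow>y. Suc n"] by (simp only: length_aggregate)
  have takes: "set (take j x) = set (take j x')" for j
    using arg_cong[OF take_aggregate_eq[OF agg, of j], of "\<lambda>y. fst ` set y"] by simp
  have ins: "insertions P x = insertions P x'" for P
    by (simp add: insertions_def takes lengths)
  have "(if x \<noteq> [] \<and> aggregate (butlast x) = y then lam (last x) * weight (butlast x) else 0) * weight x' =
        (if x' \<noteq> [] \<and> aggregate (butlast x') = y then lam (last x') * weight (butlast x') else 0) * weight x"
    using agg
  proof (induction rule: aggregate_eq_induct)
    case (new v v' d)
    show ?case using new.hyps by (simp add: weight_snoc)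
  next
    case (old v v' d d')
    show ?case using old.hyps by (simp add: weight_snoc insert_absorb)
  qed simp
  moreover have "(\<Sum>(j, c)\<in>insertions (\<lambda>c. (s, c) \<in> G) x.
        if aggregate (insert_at j c x) = y then weight (insert_at j c x) else 0) * weight x' =
      (\<Sum>(j, c)\<in>insertions (\<lambda>c. (s, c) \<in> G) x'.
        if aggregate (insert_at j c x') = y then weight (insert_at j c x') else 0) * weight x" for s
    unfolding ins sum_distrib_right
  proof (intro sum.cong refl, clarify)
    fix j c assume jc: "(j, c) \<in> insertions (\<lambda>c. (s, c) \<in> G) x'"
    then have "j \<le> length x" "c \<notin> set (take j x)"
      by (auto simp: insertions_def lengths takes)
    then show "(if aggregate (insert_at j c x) = y then weight (insert_at j c x) else 0) * weight x' =
      (if aggregate (insert_at j c x') = y then weight (insert_at j c x') else 0) * weight x"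
      using aggregate_insert_at[OF agg, of j c] weight_insert_at_cong[OF agg, of j c] by simp
  qed
  then have "(\<Sum>s\<in>UNIV. mu s * (\<Sum>(j, c)\<in>insertions (\<lambda>c. (s, c) \<in> G) x.
        if aggregate (insert_at j c x) = y then weight (insert_at j c x) else 0)) * weight x' =
      (\<Sum>s\<in>UNIV. mu s * (\<Sum>(j, c)\<in>insertions (\<lambda>c. (s, c) \<in> G) x'.
        if aggregate (insert_at j c x') = y then weight (insert_at j c x') else 0)) * weight x"
    by (simp only: sum_distrib_right mult.assoc)
  moreover have "(\<Sum>s\<in>UNIV. mu s * (if (\<forall>d\<in>set x. (s, d) \<notin> G) \<and> aggregate x = y then weight x else 0)) * weight x' =
      (\<Sum>s\<in>UNIV. mu s * (if (\<forall>d\<in>set x'. (s, d) \<notin> G) \<and> aggregate x' = y then weight x' else 0)) * weight x"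
    unfolding sum_distrib_right sets agg by (intro sum.cong refl) simp
  ultimately show ?thesis
    unfolding inflow_eq distrib_right by (simp only:)
qed

lemma inflow_nonneg: "inflow A x \<ge> 0"
  by (simp add: inflow_def sum_nonneg rate_nonneg weight_nonneg)

text \<open>\<open>r\<close> is the reversed rate from the fibre of \<open>y'\<close> to that of
  \<open>y\<close>. If all weights in the fibre of \<open>y'\<close> vanish, the inflow vanishes
  too, being at most the total inflow \<open>total_rate * weight x\<close>, and any \<open>r\<close>
  will do.\<close>

lemma inflow_proportional:
  "\<exists>r. \<forall>x. aggregate x = y' \<longrightarrow> inflow (\<lambda>x. aggregate x = y) x = r * weight x"
proof (cases "\<exists>x. aggregate x = y' \<and> weight x \<noteq> 0")
  case True
  then obtain x where x: "aggregate x = y'" "weight x \<noteq> 0" by blast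
  show ?thesis
  proof (intro exI[of _ "inflow (\<lambda>x. aggregate x = y) x / weight x"] allI impI)
    fix x' assume "aggregate x' = y'"
    then show "inflow (\<lambda>x. aggregate x = y) x' = inflow (\<lambda>x. aggregate x = y) x / weight x * weight x'"
      using inflow_cong[of x x' y] x by (simp add: field_simps)
  qed
next
  case False
  have "inflow (\<lambda>x. aggregate x = y) x = 0" if "weight x = 0" for x
  proof -
    have "inflow (\<lambda>x. aggregate x = y) x \<le> inflow (\<lambda>_. True) x"
      unfolding inflow_def
      by (intro sum_mono mult_left_mono sum_mono2 rate_nonneg) (auto simp: weight_nonneg)
    then show ?thesis using that inflow_nonneg[of "\<lambda>x. aggregate x = y" x] by (simp add: global_balance)
  qed
  then show ?thesis using False by auto
qed

end

lemma nn_integral_has_sum: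
  fixes f :: "'a \<Rightarrow> real"
  assumes "(f has_sum S) UNIV" "\<And>x. f x \<ge> 0"
  shows "(\<integral>\<^sup>+x. ennreal (f x) \<partial>count_space UNIV) = ennreal S"
proof -
  have "(\<lambda>x. norm (f x)) summable_on UNIV"
    using assms by (auto simp: summable_on_def)
  then have abs: "Infinite_Set_Sum.abs_summable_on f UNIV"
    by (simp add: abs_summable_equivalent[symmetric])
  then have "infsetsum f UNIV = S"
    using assms(1) by (simp add: infsetsum_infsum infsumI)
  then show ?thesis
    using nn_integral_conv_infsetsum[OF abs] assms(2) by simp
qed

subsection \<open>Uniqueness of stationary distributions\<close>

lemma integrable_pmf_mult:
  fixes g :: "'a \<Rightarrow> real"
  assumes "\<And>y. \<bar>g y\<bar> \<le> 1"
  shows "integrable (count_space UNIV) (\<lambda>y. pmf p y * g y)"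
    and "(\<integral>y. g y \<partial>measure_pmf p) = (\<integral>y. pmf p y * g y \<partial>count_space UNIV)"
proof -
  have "integrable (measure_pmf p) g"
    using assms by (intro measure_pmf.integrable_const_bound[where B = 1]) auto
  then show "integrable (count_space UNIV) (\<lambda>y. pmf p y * g y)"
    by (subst (asm) measure_pmf_eq_density, subst (asm) integrable_density) auto
  show "(\<integral>y. g y \<partial>measure_pmf p) = (\<integral>y. pmf p y * g y \<partial>count_space UNIV)"
    by (subst measure_pmf_eq_density, subst integral_density) auto
qed

text \<open>The function \<open>(p - q) * g\<close> is nonnegative with integral zero, hence zero
  everywhere for counting measure.\<close>

lemma pmf_diff_integral_zero:
  fixes g :: "'a \<Rightarrow> real"
  assumes "\<And>y. \<bar>g y\<bar> \<le> 1" "\<And>y. pmf q y < pmf p y \<Longrightarrow> g y \<ge> 0" "\<And>y. pmf p y < pmf q y \<Longrightarrow> g y \<le> 0"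
    and "(\<integral>y. g y \<partial>measure_pmf p) = (\<integral>y. g y \<partial>measure_pmf q)" "pmf p y \<noteq> pmf q y"
  shows "g y = 0"
proof -
  let ?h = "\<lambda>y. pmf p y * g y - pmf q y * g y"
  have int: "integrable (count_space UNIV) ?h"
    by (intro Bochner_Integration.integrable_diff integrable_pmf_mult(1) assms(1))
  have nonneg: "?h y \<ge> 0" for y
  proof -
    have "(pmf p y - pmf q y) * g y \<ge> 0"
      using assms(2,3)[of y] by (cases "pmf p y" "pmf q y" rule: linorder_cases) (auto simp: mult_nonpos_nonpos)
    then show ?thesis by (simp add: algebra_simps)
  qed
  have "(\<integral>y. ?h y \<partial>count_space UNIV) = 0"
    using assms(4)
    by (subst Bochner_Integration.integral_diff) (auto simp: integrable_pmf_mult[OF assms(1)])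
  then have "AE y in count_space UNIV. ?h y = 0"
    using integral_nonneg_eq_0_iff_AE[OF int] nonneg by simp
  then have "?h y = 0" by (simp add: AE_count_space)
  then show ?thesis using assms(5) by (simp add: left_diff_distrib[symmetric])
qed

lemma measure_bind_pmf: "measure (bind_pmf p K) A = (\<integral>y. measure (K y) A \<partial>measure_pmf p)"
proof -
  have "ennreal (measure (bind_pmf p K) A) = (\<integral>\<^sup>+y. ennreal (measure (K y) A) \<partial>measure_pmf p)"
    by (simp add: emeasure_bind_pmf measure_pmf.emeasure_eq_measure[symmetric])
  also have "\<dots> = ennreal (\<integral>y. measure (K y) A \<partial>measure_pmf p)"
    by (intro nn_integral_eq_integral measure_pmf.integrable_const_bound[where B = 1]) auto
  finally show ?thesis by (subst (asm) ennreal_inj) (auto intro!: integral_nonneg_AE)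
qed

text \<open>If \<open>A\<close> is the set where \<open>p\<close> exceeds \<open>q\<close>, then \<open>indicator A - K(_, A)\<close> has integral zero
  against \<open>p - q\<close> although that integrand is nonnegative; hence \<open>K(y, A) = 1\<close> on \<open>A\<close>.\<close>

lemma stationary_excess_closed:
  assumes "stationary_distribution K p" "stationary_distribution K q"
    and "pmf q y < pmf p y" "y' \<in> set_pmf (K y)"
  shows "pmf q y' < pmf p y'"
proof -
  define A where "A = {y. pmf q y < pmf p y}"
  define g where "g y = indicator A y - measure (K y) A" for y
  have bounds: "0 \<le> measure (K y) A" "measure (K y) A \<le> 1" for y
    by simp_all
  have "(\<integral>y. g y \<partial>measure_pmf r) = 0" if "stationary_distribution K r" for r
  proof -
    have "(\<integral>y. measure (K y) A \<partial>measure_pmf r) = measure r A"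
      using that measure_bind_pmf[of r K A] by (simp add: stationary_distribution_def)
    moreover have "integrable (measure_pmf r) (\<lambda>y. measure (K y) A)"
      by (intro measure_pmf.integrable_const_bound[where B = 1]) auto
    moreover have "integrable (measure_pmf r) (\<lambda>y. indicator A y :: real)"
      by (intro measure_pmf.integrable_const_bound[where B = 1]) auto
    ultimately show ?thesis unfolding g_def by simp
  qed
  moreover have "\<bar>g y\<bar> \<le> 1" "y \<in> A \<Longrightarrow> g y \<ge> 0" "y \<notin> A \<Longrightarrow> g y \<le> 0" for y
    using bounds[of y] unfolding g_def by (cases "y \<in> A"; simp)+
  ultimately have "g y = 0"
    using assms by (intro pmf_diff_integral_zero[of g q p y]) (auto simp: A_def)
  then have "measure (K y) A = 1"
    using assms by (simp add: g_def A_def)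
  then have "set_pmf (K y) \<subseteq> A"
    using measure_pmf.prob_eq_1[of A "K y"] by (auto simp: AE_measure_pmf_iff)
  then show ?thesis using assms(4) by (auto simp: A_def)
qed

lemma pmf_le_imp_eq:
  assumes "\<And>y. pmf p y \<le> pmf q y"
  shows "p = q"
proof (rule pmf_eqI, rule ccontr)
  fix y assume "pmf p y \<noteq> pmf q y"
  \<comment> \<open>The constant \<open>- 1\<close> has the required signs because \<open>p\<close>
    never exceeds \<open>q\<close>, and its two integrals agree because both laws have mass
    1.\<close>
  then have "(- 1 :: real) = 0"
    by (intro pmf_diff_integral_zero[of "\<lambda>_. - 1" q p y]) (use assms in \<open>auto simp: leD\<close>)
  then show False by simp
qed

text \<open>The sets where \<open>p\<close> exceeds \<open>q\<close> and where \<open>q\<close>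
  exceeds \<open>p\<close> are both closed under transitions, so each contains \<open>r\<close> if
  it is nonempty. They are disjoint, hence one of them is empty, and equal total mass gives
  equality.\<close>

lemma stationary_distribution_unique:
  assumes reach: "\<And>y. (y, r) \<in> {(y, y'). y' \<in> set_pmf (K y)}\<^sup>*"
    and p: "stationary_distribution K p" and q: "stationary_distribution K q"
  shows "p = q"
proof -
  have excess: "pmf q r < pmf p r"
    if pq: "stationary_distribution K p" "stationary_distribution K q" and y: "pmf q y < pmf p y" for p q y
    using reach[of y] y
  proof (induction rule: converse_rtrancl_induct)
    case (step y z)
    then show ?case using stationary_excess_closed[OF pq] by simp
  qed
  show ?thesis
  proof (cases "\<exists>y. pmf q y < pmf p y")
    case True
    then have "pmf q r < pmf p r" using excess[OF p q] by blast
    then have "pmf q y \<le> pmf p y" for y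
      using excess[OF q p, of y] by force
    then show ?thesis using pmf_le_imp_eq[of q p] by simp
  next
    case False
    then show ?thesis by (intro pmf_le_imp_eq) (simp add: not_less)
  qed
qed

subsection \<open>Normalization\<close>

text \<open>The orderings of the \<open>k\<close>-element sets, over all \<open>k\<close>, are
  exactly the duplicate-free lists.\<close>

lemma sum_permutations:
  fixes f :: "'c::finite list \<Rightarrow> nat \<Rightarrow> real"
  shows "(\<Sum>k = 0..CARD('c). \<Sum>C | card C = k. \<Sum>cs\<in>permutations_of_set C. \<Prod>l<k. f cs l) =
     (\<Sum>cs | distinct cs. \<Prod>l<length cs. f cs l)"
proof -
  have "(\<Sum>k = 0..CARD('c). \<Sum>C | card C = k. \<Sum>cs\<in>permutations_of_set C. \<Prod>l<k. f cs l) =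
    (\<Sum>k = 0..CARD('c). \<Sum>C\<in>{C. C \<in> UNIV \<and> card C = k}. \<Sum>cs\<in>{cs. cs \<in> {cs. distinct cs} \<and> set cs = C}. \<Prod>l<length cs. f cs l)"
  proof (intro sum.cong prod.cong)
    fix k and C :: "'c set" and cs
    assume "C \<in> {C. C \<in> UNIV \<and> card C = k}" "cs \<in> {cs. cs \<in> {cs. distinct cs} \<and> set cs = C}"
    then show "{..<k} = {..<length cs}" using distinct_card by fastforce
  qed (auto simp: permutations_of_set_def)
  also have "\<dots> = (\<Sum>C\<in>UNIV. \<Sum>cs\<in>{cs. cs \<in> {cs. distinct cs} \<and> set cs = C}. \<Prod>l<length cs. f cs l)"
    by (rule sum.group) (auto simp: card_mono)
  also have "\<dots> = (\<Sum>cs | distinct cs. \<Prod>l<length cs. f cs l)"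
    by (rule sum.group) (auto simp: finite_subset_distinct[of UNIV, simplified])
  finally show ?thesis .
qed

context matching_rates
begin

lemma aggregate_vimage_new:
  assumes "d \<notin> fst ` set y"
  shows "{x. aggregate x = y @ [(d, 0)]} = (\<lambda>x. x @ [d]) ` {x. aggregate x = y}"
proof (intro equalityI subsetI)
  fix x assume "x \<in> {x. aggregate x = y @ [(d, 0)]}"
  then have x: "aggregate x = y @ [(d, 0)]" by simp
  then obtain v e where v: "x = v @ [e]" by (cases x rule: rev_cases) auto
  then show "x \<in> (\<lambda>x. x @ [d]) ` {x. aggregate x = y}"
    using x by (cases "e \<in> set v") (auto simp: aggregate_snoc add_last_neq_new)
next
  fix x assume "x \<in> (\<lambda>x. x @ [d]) ` {x. aggregate x = y}"
  then show "x \<in> {x. aggregate x = y @ [(d, 0)]}"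
    using assms by (auto simp: aggregate_snoc)
qed

text \<open>The free choice of the repeated type is what produces the ratio
  \<open>sum lam C / capacity C\<close> when weights are summed over a fibre.\<close>

lemma aggregate_vimage_old:
  assumes "y \<noteq> []"
  shows "{x. aggregate x = add_last y} = (\<lambda>(x, d). x @ [d]) ` ({x. aggregate x = y} \<times> fst ` set y)"
proof (intro equalityI subsetI)
  fix x assume "x \<in> {x. aggregate x = add_last y}"
  then have x: "aggregate x = add_last y" by simp
  then obtain v e where v: "x = v @ [e]" by (cases x rule: rev_cases) (auto simp: add_last_def)
  have "e \<in> set v"
    using x add_last_neq_new[of y "aggregate v" e] by (auto simp: v aggregate_snoc split: if_splits)
  moreover from this have "aggregate v \<noteq> []" by auto
  ultimately have "aggregate v = y"
    using x add_last_inj[OF _ assms, of "aggregate v"] by (simp add: v aggregate_snoc)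
  then show "x \<in> (\<lambda>(x, d). x @ [d]) ` ({x. aggregate x = y} \<times> fst ` set y)"
    using \<open>e \<in> set v\<close> v fst_set_aggregate[of v] by (auto intro!: image_eqI[of _ _ "(v, e)"])
next
  fix x assume "x \<in> (\<lambda>(x, d). x @ [d]) ` ({x. aggregate x = y} \<times> fst ` set y)"
  then obtain v d where v: "x = v @ [d]" "aggregate v = y" "d \<in> fst ` set y" by auto
  then have "d \<in> set v" using fst_set_aggregate[of v] by simp
  then show "x \<in> {x. aggregate x = add_last y}"
    using v by (simp add: aggregate_snoc)
qed

text \<open>Induction on the number of agents: the last one is either the first of its type, which
  is then determined, or of any type already present, which sums to one more geometric
  factor.\<close>

lemma sum_weight_aggregate:
  "y \<in> Y_states \<Longrightarrow> (\<Sum>x | aggregate x = y. weight x) = aggregate_weight y"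
proof (induction "\<Sum>(c, n)\<leftarrow>y. Suc n" arbitrary: y rule: less_induct)
  case less
  show ?case
  proof (cases y rule: rev_cases)
    case Nil
    then show ?thesis by simp
  next
    case (snoc u a)
    obtain d n where a: "a = (d, n)" by (cases a)
    show ?thesis
    proof (cases n)
      case 0
      have u: "u \<in> Y_states" "d \<notin> fst ` set u"
        using less.prems by (auto simp: snoc a Y_states_def)
      have sets: "set x = fst ` set u" if "aggregate x = u" for x
        using that fst_set_aggregate[of x] by simp
      have "(\<Sum>x | aggregate x = y. weight x) = (\<Sum>x | aggregate x = u. weight (x @ [d]))"
        unfolding snoc a 0 aggregate_vimage_new[OF u(2)]
        by (subst sum.reindex) (auto simp: inj_on_def)
      also have "\<dots> = (\<Sum>x | aggregate x = u. weight x * (lam d / capacity (insert d (fst ` set u))))"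
        by (intro sum.cong) (auto simp: weight_snoc sets)
      also have "\<dots> = aggregate_weight u * (lam d / capacity (insert d (fst ` set u)))"
        unfolding sum_distrib_right[symmetric] using less.hyps[of u] u by (simp add: snoc a)
      finally show ?thesis by (simp add: snoc a 0 aggregate_weight_snoc)
    next
      case (Suc m)
      define v where "v = u @ [(d, m)]"
      have y: "y = add_last v" by (simp add: snoc a Suc v_def)
      have v: "v \<in> Y_states" "v \<noteq> []"
        using less.prems by (auto simp: snoc a v_def Y_states_def)
      have sets: "set x = fst ` set v" if "aggregate x = v" for x
        using that fst_set_aggregate[of x] by simp
      have "(\<Sum>x | aggregate x = y. weight x) =
          (\<Sum>(x, e)\<in>{x. aggregate x = v} \<times> fst ` set v. weight (x @ [e]))"
        unfolding y aggregate_vimage_old[OF v(2)]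
        by (subst sum.reindex) (auto simp: inj_on_def o_def intro!: sum.cong)
      also have "\<dots> = (\<Sum>x | aggregate x = v. \<Sum>e\<in>fst ` set v. weight (x @ [e]))"
        by (rule sum.cartesian_product[symmetric])
      also have "\<dots> = (\<Sum>x | aggregate x = v. weight x * (sum lam (fst ` set v) / capacity (fst ` set v)))"
        by (intro sum.cong refl)
          (auto simp: weight_snoc sets insert_absorb sum_distrib_left[symmetric] sum_divide_distrib[symmetric])
      also have "\<dots> = aggregate_weight v * (sum lam (fst ` set v) / capacity (fst ` set v))"
        unfolding sum_distrib_right[symmetric] using less.hyps[of v] v by (simp add: snoc a Suc v_def)
      finally show ?thesis by (simp add: y aggregate_weight_add_last v(2))
    qed
  qed
qed

text \<open>The total \<open>aggregate_weight\<close> of all states with the type order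
  \<open>cs\<close>: each geometric series turns a denominator \<open>capacity\<close> into
  \<open>capacity - sum lam\<close>.\<close>

definition order_weight :: "'c list \<Rightarrow> real" where
  "order_weight cs = (\<Prod>l<length cs. lam (cs ! l) /
     (capacity (set (take (Suc l) cs)) - sum lam (set (take (Suc l) cs))))"

lemma order_weight_snoc:
  "order_weight (cs @ [c]) = order_weight cs *
     (lam c / (capacity (insert c (set cs)) - sum lam (insert c (set cs))))"
proof -
  have "(\<Prod>l<length cs. lam ((cs @ [c]) ! l) / (capacity (set (take (Suc l) (cs @ [c]))) - sum lam (set (take (Suc l) (cs @ [c])))))
    = order_weight cs"
    unfolding order_weight_def by (rule prod.cong) (auto simp: nth_append)
  then show ?thesis by (simp add: order_weight_def[of "cs @ [c]"] nth_append)
qed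

lemma aggregate_weight_nonneg: "aggregate_weight y \<ge> 0"
  by (simp add: aggregate_weight_def prod_nonneg lam_nonneg capacity_nonneg sum_nonneg)

lemma has_sum_geometric_tail:
  "((\<lambda>n. lam c / capacity (insert c C) * (sum lam (insert c C) / capacity (insert c C)) ^ n)
     has_sum lam c / (capacity (insert c C) - sum lam (insert c C))) UNIV"
proof -
  let ?k = "capacity (insert c C)" and ?s = "sum lam (insert c C)"
  have less: "?s < ?k" "0 \<le> ?s" "0 < ?k"
    using load_less_capacity[of "insert c C"] by (auto simp: sum_nonneg lam_nonneg)
  then have "(\<lambda>n. (?s / ?k) ^ n) sums (1 / (1 - ?s / ?k))"
    by (intro geometric_sums) simp
  then have "(\<lambda>n. lam c / ?k * (?s / ?k) ^ n) sums (lam c / ?k * (1 / (1 - ?s / ?k)))"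
    by (rule sums_mult)
  also have "lam c / ?k * (1 / (1 - ?s / ?k)) = lam c / (?k - ?s)"
    using less by (simp add: field_simps)
  finally show ?thesis
    by (rule sums_nonneg_imp_has_sum) (use less lam_nonneg[of c] in auto)
qed

lemma has_sum_order_weight:
  "(aggregate_weight has_sum order_weight cs) {y. map fst y = cs}"
proof (induction cs rule: rev_induct)
  case Nil
  then show ?case by (simp add: order_weight_def has_sum_finite_iff)
next
  case (snoc c cs)
  let ?Y = "{y. map fst y = cs}" and ?j = "\<lambda>(y, n). y @ [(c, n)]"
  let ?C = "insert c (set cs)"
  have image: "{y. map fst y = cs @ [c]} = ?j ` (?Y \<times> UNIV)"
  proof (intro equalityI subsetI)
    fix y assume y: "y \<in> {y. map fst y = cs @ [c]}"
    then show "y \<in> ?j ` (?Y \<times> UNIV)"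
      by (cases y rule: rev_cases) (auto simp: image_def)
  qed auto
  have inner: "((\<lambda>n. (aggregate_weight \<circ> ?j) (y, n)) has_sum aggregate_weight y * (lam c / (capacity ?C - sum lam ?C))) UNIV"
    if "y \<in> ?Y" for y
  proof -
    have "fst ` set y = set cs" using that by force
    then show ?thesis
      using has_sum_cmult_right[OF has_sum_geometric_tail[of c "set cs"], of "aggregate_weight y"]
      by (simp add: aggregate_weight_snoc)
  qed
  have outer: "((\<lambda>y. aggregate_weight y * (lam c / (capacity ?C - sum lam ?C))) has_sum
      order_weight (cs @ [c])) ?Y"
    unfolding order_weight_snoc by (rule has_sum_cmult_left[OF snoc.IH])
  have "((aggregate_weight \<circ> ?j) has_sum order_weight (cs @ [c])) (Sigma ?Y (\<lambda>_. UNIV))"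
  proof (rule has_sum_SigmaI[OF inner outer])
    show "(aggregate_weight \<circ> ?j) summable_on Sigma ?Y (\<lambda>_. UNIV)"
      using outer by (intro summable_on_SigmaI[OF inner]) (auto simp: summable_on_def aggregate_weight_nonneg)
  qed auto
  then show ?case
    unfolding image by (subst has_sum_reindex) (auto simp: inj_on_def)
qed

definition normalizer :: real where
  "normalizer = (\<Sum>cs | distinct cs. order_weight cs)"

lemma has_sum_aggregate_weight: "(aggregate_weight has_sum normalizer) Y_states"
proof -
  \<comment> \<open>\<open>?h\<close> tags a state with its order of types, which presents
    \<open>Y_states\<close> as a dependent sum over the duplicate-free lists.\<close>
  let ?D = "{cs :: 'c list. distinct cs}" and ?h = "\<lambda>y :: ('c \<times> nat) list. (map fst y, y)"
  have outer: "(order_weight has_sum normalizer) ?D"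
    unfolding normalizer_def by (rule has_sum_finite) (simp add: finite_subset_distinct[of UNIV, simplified])
  have "((aggregate_weight \<circ> snd) has_sum normalizer) (Sigma ?D (\<lambda>cs. {y. map fst y = cs}))"
  proof (rule has_sum_SigmaI[OF _ outer])
    show "(aggregate_weight \<circ> snd) summable_on Sigma ?D (\<lambda>cs. {y. map fst y = cs})"
      using outer
      by (intro summable_on_SigmaI[where g = order_weight])
        (auto simp: summable_on_def aggregate_weight_nonneg has_sum_order_weight)
  qed (simp add: has_sum_order_weight)
  also have "Sigma ?D (\<lambda>cs. {y. map fst y = cs}) = ?h ` Y_states"
    by (auto simp: Y_states_def)
  finally show ?thesis
    by (subst (asm) has_sum_reindex) (auto simp: inj_on_def o_def)
qed

text \<open>Summing by fibres of \<open>aggregate\<close> shows that the queue and its aggregate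
  have the same normalizing constant.\<close>

lemma has_sum_weight: "(weight has_sum normalizer) UNIV"
proof -
  let ?h = "\<lambda>x. (aggregate x, x)"
  have inner: "((\<lambda>x. (weight \<circ> snd) (y, x)) has_sum aggregate_weight y) {x. aggregate x = y}"
    if "y \<in> Y_states" for y
    using sum_weight_aggregate[OF that] by (simp add: has_sum_finite_iff)
  have "((weight \<circ> snd) has_sum normalizer) (Sigma Y_states (\<lambda>y. {x. aggregate x = y}))"
  proof (rule has_sum_SigmaI[OF inner has_sum_aggregate_weight])
    show "(weight \<circ> snd) summable_on Sigma Y_states (\<lambda>y. {x. aggregate x = y})"
      using inner has_sum_aggregate_weight
      by (intro summable_on_SigmaI[where g = aggregate_weight]) (auto simp: summable_on_def weight_nonneg)
  qed
  also have "Sigma Y_states (\<lambda>y. {x. aggregate x = y}) = ?h ` UNIV"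
    using aggregate_in_Y_states by auto
  finally show ?thesis
    by (subst (asm) has_sum_reindex) (auto simp: inj_on_def o_def)
qed

lemma normalizer_pos: "normalizer > 0"
proof -
  have "order_weight cs \<ge> 0" for cs
    unfolding order_weight_def
  proof (intro prod_nonneg divide_nonneg_nonneg lam_nonneg ballI)
    fix l assume "l \<in> {..<length cs}"
    then have "set (take (Suc l) cs) \<noteq> {}" by (cases cs) auto
    then show "0 \<le> capacity (set (take (Suc l) cs)) - sum lam (set (take (Suc l) cs))"
      using load_less_capacity[of "set (take (Suc l) cs)"] by linarith
  qed
  then have "order_weight [] \<le> normalizer"
    unfolding normalizer_def
    by (intro member_le_sum) (auto simp: finite_subset_distinct[of UNIV, simplified])
  then show ?thesis by (simp add: order_weight_def)
qed

end

section \<open>Monotonicity and stationary law of the list chain\<close>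

lemma subseq_remove_first_self: "subseq (remove_first P q) q"
  by (induction q) auto

text \<open>A good that takes an extra agent of the longer list leaves behind everything the shorter
  list embeds into, and the shorter list can only shrink.\<close>

lemma subseq_remove_first: "subseq x x' \<Longrightarrow> subseq (remove_first P x) (remove_first P x')"
proof (induction rule: list_emb.induct)
  case (list_emb_Cons xs ys y)
  then show ?case using subseq_remove_first_self[of P xs] by (auto intro: subseq_order.trans)
next
  case (list_emb_Cons2 x y xs ys)
  then show ?case by auto
qed simp

lemma subseq_step: "subseq x x' \<Longrightarrow> subseq (step G i x) (step G i x')"
  by (cases i) (auto simp: subseq_remove_first)

context matching_rates
begin

definition item_pmf :: "('c, 's) item pmf" where
  "item_pmf = embed_pmf (\<lambda>i. rate i / total_rate)"

lemma sum_rate: "(\<Sum>i\<in>UNIV. rate i) = total_rate"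
  by (simp add: sum_item total_rate_def)

lemma pmf_item: "pmf item_pmf i = rate i / total_rate"
  unfolding item_pmf_def
proof (rule pmf_embed_pmf)
  show "0 \<le> rate i / total_rate" for i
    using rate_nonneg[of i] total_rate_pos by simp
  have "(\<Sum>i\<in>UNIV. rate i / total_rate) = 1"
    using sum_rate total_rate_pos by (simp add: sum_divide_distrib[symmetric])
  then show "(\<integral>\<^sup>+i. ennreal (rate i / total_rate) \<partial>count_space UNIV) = 1"
    using rate_nonneg total_rate_pos
    by (subst nn_integral_count_space_finite) (auto simp: sum_ennreal)
qed

definition queue_pmf :: "'c list pmf" where
  "queue_pmf = embed_pmf (\<lambda>x. weight x / normalizer)"

lemma pmf_queue: "pmf queue_pmf x = weight x / normalizer"
  unfolding queue_pmf_def
proof (rule pmf_embed_pmf)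
  show nonneg: "0 \<le> weight x / normalizer" for x
    using weight_nonneg[of x] normalizer_pos by simp
  have "((\<lambda>x. weight x / normalizer) has_sum 1) UNIV"
    using has_sum_cmult_left[OF has_sum_weight, of "inverse normalizer"] normalizer_pos
    by (simp add: field_simps)
  then show "(\<integral>\<^sup>+x. ennreal (weight x / normalizer) \<partial>count_space UNIV) = 1"
    using nn_integral_has_sum nonneg by fastforce
qed

definition queue_kernel :: "'c list \<Rightarrow> 'c list pmf" where
  "queue_kernel x = map_pmf (\<lambda>i. step G i x) item_pmf"

lemma measure_bind_kernel:
  "measure (bind_pmf p queue_kernel) A = (\<Sum>i\<in>UNIV. rate i / total_rate * measure p {x. step G i x \<in> A})"
proof -
  have "bind_pmf p queue_kernel = bind_pmf item_pmf (\<lambda>i. map_pmf (step G i) p)"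
    unfolding queue_kernel_def map_pmf_def by (rule bind_commute_pmf)
  then have "measure (bind_pmf p queue_kernel) A = (\<integral>i. measure p {x. step G i x \<in> A} \<partial>item_pmf)"
    by (simp add: measure_bind_pmf vimage_def)
  also have "\<dots> = (\<Sum>i\<in>UNIV. rate i / total_rate * measure p {x. step G i x \<in> A})"
    by (subst integral_measure_pmf[of UNIV]) (simp_all add: pmf_item)
  finally show ?thesis .
qed

lemma pmf_bind_kernel:
  "pmf (bind_pmf p queue_kernel) x' = (\<Sum>i\<in>UNIV. rate i / total_rate * measure p {x. step G i x = x'})"
  using measure_bind_kernel[of p "{x'}"] by (simp add: measure_pmf_single)

lemma stationary_queue: "stationary_distribution queue_kernel queue_pmf"
  unfolding stationary_distribution_def
proof (rule pmf_eqI)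
  fix x'
  have "pmf (bind_pmf queue_pmf queue_kernel) x' =
      (\<Sum>i\<in>UNIV. rate i / total_rate * ((\<Sum>x | step G i x = x'. weight x) / normalizer))"
    by (simp add: pmf_bind_kernel measure_measure_pmf_finite pmf_queue sum_divide_distrib[symmetric])
  also have "\<dots> = inflow (\<lambda>_. True) x' / (total_rate * normalizer)"
    by (simp add: inflow_def sum_divide_distrib[where A = UNIV])
  also have "\<dots> = pmf queue_pmf x'"
    using total_rate_pos by (simp add: global_balance pmf_queue)
  finally show "pmf (bind_pmf queue_pmf queue_kernel) x' = pmf queue_pmf x'" .
qed

text \<open>Since \<open>capacity {c} > 0\<close> for the head type \<open>c\<close>, some good of
  positive rate removes the head. Thus \<open>[]\<close> is reachable from every list, as the
  uniqueness argument requires.\<close>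

lemma queue_kernel_decreasing:
  assumes "x \<noteq> []"
  obtains x' where "x' \<in> set_pmf (queue_kernel x)" "length x' < length x"
proof -
  obtain c v where x: "x = c # v" using assms by (cases x) auto
  have "capacity {c} > 0" by simp
  then obtain s where s: "s \<in> compatible_goods G {c}" "mu s > 0"
    unfolding capacity_def using sum_nonpos[of "compatible_goods G {c}" mu] by force
  then have "Good s \<in> set_pmf item_pmf"
    using total_rate_pos by (simp add: set_pmf_iff pmf_item)
  then have "step G (Good s) x \<in> set_pmf (queue_kernel x)"
    unfolding queue_kernel_def set_map_pmf by (rule imageI)
  moreover have "step G (Good s) x = v"
    using s by (simp add: x compatible_goods_def)
  ultimately show ?thesis
    using that[of v] by (simp add: x)
qed

lemma queue_kernel_reaches_empty: "(x, []) \<in> {(x, x'). x' \<in> set_pmf (queue_kernel x)}\<^sup>*"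
proof (induction "length x" arbitrary: x rule: less_induct)
  case less
  show ?case
  proof (cases "x = []")
    case False
    then obtain x' where "x' \<in> set_pmf (queue_kernel x)" "length x' < length x"
      by (rule queue_kernel_decreasing)
    then show ?thesis using less by (auto intro: converse_rtrancl_into_rtrancl)
  qed simp
qed

lemma queue_unique: "stationary_distribution queue_kernel p \<Longrightarrow> p = queue_pmf"
  by (rule stationary_distribution_unique[OF queue_kernel_reaches_empty _ stationary_queue])

primrec queue_kernel_power :: "nat \<Rightarrow> 'c list \<Rightarrow> 'c list pmf" where
  "queue_kernel_power 0 x = return_pmf x"
| "queue_kernel_power (Suc n) x = bind_pmf (queue_kernel_power n x) queue_kernel"

text \<open>The definition splits off the last step, as suits a run extended by one item; the
  monotonicity induction has to split off the first.\<close>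

lemma queue_kernel_power_Suc: "queue_kernel_power (Suc n) x = bind_pmf (queue_kernel x) (queue_kernel_power n)"
  by (induction n) (simp_all add: bind_return_pmf bind_return_pmf' bind_assoc_pmf)

text \<open>The queue started empty stays a subsequence of the one started from any other state.\<close>

lemma queue_kernel_power_empty_mono:
  "subseq x x' \<Longrightarrow> pmf (queue_kernel_power n x') [] \<le> pmf (queue_kernel_power n x) []"
proof (induction n arbitrary: x x')
  case (Suc n)
  have eq: "pmf (queue_kernel_power (Suc n) x) [] =
      (\<Sum>i\<in>UNIV. rate i / total_rate * pmf (queue_kernel_power n (step G i x)) [])" for x
    unfolding queue_kernel_power_Suc queue_kernel_def
    by (simp add: bind_map_pmf pmf_bind integral_measure_pmf[of UNIV] pmf_item)
  show ?case
    unfolding eq using Suc.prems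
    by (intro sum_mono mult_left_mono Suc.IH subseq_step)
      (auto simp: rate_nonneg total_rate_pos less_imp_le)
qed (auto simp: indicator_def)

lemma stationary_kernel_power: "bind_pmf queue_pmf (queue_kernel_power n) = queue_pmf"
proof (induction n)
  case (Suc n)
  have "bind_pmf queue_pmf (queue_kernel_power (Suc n)) = bind_pmf (bind_pmf queue_pmf (queue_kernel_power n)) queue_kernel"
    by (simp add: bind_assoc_pmf queue_kernel_power.simps(2)[abs_def])
  also have "\<dots> = queue_pmf"
    using stationary_queue unfolding Suc stationary_distribution_def .
  finally show ?case .
qed (simp add: bind_return_pmf')

text \<open>The stationary probability of \<open>[]\<close> is an average of the
  \<open>n\<close>-step probabilities of reaching \<open>[]\<close> over all starting lists, and the
  empty start maximizes them.\<close>

lemma queue_kernel_power_empty_ge: "pmf queue_pmf [] \<le> pmf (queue_kernel_power n []) []"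
proof -
  have "pmf queue_pmf [] = (\<integral>x. pmf (queue_kernel_power n x) [] \<partial>queue_pmf)"
    using pmf_bind[of queue_pmf "queue_kernel_power n" "[]"] by (simp add: stationary_kernel_power)
  also have "\<dots> \<le> (\<integral>x. pmf (queue_kernel_power n []) [] \<partial>queue_pmf)"
    by (intro integral_mono measure_pmf.integrable_const_bound[where B = 1])
      (auto simp: pmf_le_1 queue_kernel_power_empty_mono)
  finally show ?thesis by simp
qed

lemma queue_empty_pos: "pmf queue_pmf [] > 0"
  using normalizer_pos by (simp add: pmf_queue)

subsection \<open>The aggregated chain\<close>

definition aggregate_pmf :: "('c \<times> nat) list pmf" where
  "aggregate_pmf = map_pmf aggregate queue_pmf"

text \<open>Outside the support of the stationary distribution the transitions are immaterial; jumping
  to the empty state makes the stationary distribution unique.\<close>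

definition aggregate_kernel :: "('c \<times> nat) list \<Rightarrow> ('c \<times> nat) list pmf" where
  "aggregate_kernel y = (if y \<in> set_pmf aggregate_pmf
     then map_pmf aggregate (bind_pmf (cond_pmf queue_pmf {x. aggregate x = y}) queue_kernel)
     else return_pmf [])"

lemma pmf_aggregate:
  "pmf aggregate_pmf y = (\<Sum>x | aggregate x = y. weight x) / normalizer"
  by (simp add: aggregate_pmf_def pmf_map vimage_def measure_measure_pmf_finite pmf_queue
      sum_divide_distrib)

lemma set_pmf_aggregate_nonempty:
  "y \<in> set_pmf aggregate_pmf \<Longrightarrow> set_pmf queue_pmf \<inter> {x. aggregate x = y} \<noteq> {}"
  by (auto simp: aggregate_pmf_def)

text \<open>Multiplied by the weight of the fibre, the averaging formula also holds for fibres of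
  weight zero, where both sides are 0.\<close>

lemma aggregate_kernel_weight:
  "pmf (aggregate_kernel y) y' * (\<Sum>x | aggregate x = y. weight x) =
     (\<Sum>i\<in>UNIV. rate i / total_rate * (\<Sum>x | aggregate x = y \<and> aggregate (step G i x) = y'. weight x))"
proof (cases "y \<in> set_pmf aggregate_pmf")
  case True
  note ne = set_pmf_aggregate_nonempty[OF True]
  define W where "W = (\<Sum>x | aggregate x = y. weight x)"
  define q where "q = cond_pmf queue_pmf {x. aggregate x = y}"
  have W: "W \<noteq> 0"
    using True by (simp add: set_pmf_iff pmf_aggregate W_def)
  have pmf_q: "pmf q x = (if aggregate x = y then weight x / W else 0)" for x
    using ne normalizer_pos
    by (simp add: q_def pmf_cond pmf_queue measure_measure_pmf_finite W_def
        sum_divide_distrib[symmetric])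
  have q: "measure q A = (\<Sum>x | aggregate x = y \<and> x \<in> A. weight x) / W" for A
  proof -
    have "measure q A = measure q ({x. aggregate x = y} \<inter> A)"
      using ne by (intro measure_eq_AE) (auto simp: AE_measure_pmf_iff q_def)
    also have "\<dots> = (\<Sum>x\<in>{x. aggregate x = y} \<inter> A. weight x / W)"
      by (subst measure_measure_pmf_finite) (auto simp: pmf_q intro!: sum.cong)
    finally show ?thesis by (simp add: sum_divide_distrib Collect_conj_eq)
  qed
  have "pmf (aggregate_kernel y) y' = measure (bind_pmf q queue_kernel) {x. aggregate x = y'}"
    using True by (simp add: aggregate_kernel_def q_def pmf_map vimage_def)
  also have "\<dots> = (\<Sum>i\<in>UNIV. rate i / total_rate * (\<Sum>x | aggregate x = y \<and> aggregate (step G i x) = y'. weight x)) / W"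
    by (simp add: measure_bind_kernel q sum_divide_distrib[where A = UNIV])
  finally show ?thesis using W by (simp add: W_def)
next
  case False
  then have "(\<Sum>x | aggregate x = y. weight x) = 0"
    using normalizer_pos by (simp add: set_pmf_iff pmf_aggregate)
  then have zero: "weight x = 0" if "aggregate x = y" for x
    using that by (subst (asm) sum_nonneg_eq_0_iff) (auto simp: weight_nonneg)
  show ?thesis by (simp add: zero)
qed

text \<open>Drawing an aggregate and then a queue from its conditional law restores
  \<open>queue_pmf\<close>, which one step of the list chain preserves.\<close>

lemma stationary_aggregate: "stationary_distribution aggregate_kernel aggregate_pmf"
proof -
  have "bind_pmf aggregate_pmf (\<lambda>y. cond_pmf queue_pmf {x. aggregate x = y}) = queue_pmf"
  proof (rule bind_cond_pmf_cancel)
    fix y and x :: "'c list" assume "aggregate x = y"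
    then have "{y. aggregate x = y} = {y}" by auto
    then show "measure queue_pmf {x. aggregate x = y} = measure aggregate_pmf {y. aggregate x = y}"
      by (simp add: measure_pmf_single aggregate_pmf_def pmf_map vimage_def)
  qed (auto simp: set_pmf_aggregate_nonempty, auto simp: aggregate_pmf_def)
  then have "map_pmf aggregate (bind_pmf (bind_pmf aggregate_pmf
      (\<lambda>y. cond_pmf queue_pmf {x. aggregate x = y})) queue_kernel) = aggregate_pmf"
    using stationary_queue by (simp add: stationary_distribution_def aggregate_pmf_def)
  moreover have "bind_pmf aggregate_pmf aggregate_kernel = bind_pmf aggregate_pmf
     (\<lambda>y. map_pmf aggregate (bind_pmf (cond_pmf queue_pmf {x. aggregate x = y}) queue_kernel))"
    by (rule bind_pmf_cong) (simp_all add: aggregate_kernel_def)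
  ultimately show ?thesis
    by (simp add: stationary_distribution_def map_bind_pmf bind_assoc_pmf)
qed

text \<open>Inside the support a descending path of lists projects to the aggregates, and
  stationarity keeps it in the support. Outside, the kernel jumps to \<open>[]\<close> at
  once.\<close>

lemma aggregate_kernel_reaches_empty:
  "(y, []) \<in> {(y, y'). y' \<in> set_pmf (aggregate_kernel y)}\<^sup>*" (is "_ \<in> ?R\<^sup>*")
proof (cases "y \<in> set_pmf aggregate_pmf")
  case True
  have "(aggregate x, []) \<in> ?R\<^sup>*" if "x \<in> set_pmf queue_pmf" for x
    using that
  proof (induction "length x" arbitrary: x rule: less_induct)
    case less
    show ?case
    proof (cases "x = []")
      case False
      then obtain x' where x': "x' \<in> set_pmf (queue_kernel x)" "length x' < length x"
        by (rule queue_kernel_decreasing)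
      then have "x' \<in> set_pmf (bind_pmf queue_pmf queue_kernel)"
        using less.prems by auto
      then have "x' \<in> set_pmf queue_pmf"
        using stationary_queue by (simp only: stationary_distribution_def)
      then have "(aggregate x', []) \<in> ?R\<^sup>*" using less x' by blast
      moreover have "aggregate x \<in> set_pmf aggregate_pmf"
        using less.prems by (simp add: aggregate_pmf_def)
      then have "aggregate x' \<in> set_pmf (aggregate_kernel (aggregate x))"
        using less.prems x'(1) set_pmf_aggregate_nonempty[of "aggregate x"]
        by (auto simp: aggregate_kernel_def intro!: imageI)
      ultimately show ?thesis by (auto intro: converse_rtrancl_into_rtrancl)
    qed simp
  qed
  then show ?thesis using True by (auto simp: aggregate_pmf_def)
next
  case False
  then have "(y, []) \<in> ?R" by (simp add: aggregate_kernel_def)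
  then show ?thesis by blast
qed

lemma aggregate_unique: "stationary_distribution aggregate_kernel p \<longleftrightarrow> p = aggregate_pmf"
  using stationary_distribution_unique[OF aggregate_kernel_reaches_empty _ stationary_aggregate]
    stationary_aggregate by blast

end

subsection \<open>Pathwise construction of the matching\<close>

definition place :: "('s \<times> 'c) set \<Rightarrow> ('c, 's) item \<Rightarrow> int \<Rightarrow> (int \<times> 'c) list \<Rightarrow> (int \<times> 'c) list" where
  "place G i p q =
     (case i of Agent c \<Rightarrow> q @ [(p, c)] | Good s \<Rightarrow> remove_first (\<lambda>a. (s, snd a) \<in> G) q)"

lemma place_simps [simp]:
  "place G (Agent c) p q = q @ [(p, c)]"
  "place G (Good s) p q = remove_first (\<lambda>a. (s, snd a) \<in> G) q"
  by (simp_all add: place_def)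

lemma map_snd_place: "map snd (place G i p q) = step G i (map snd q)"
  by (cases i) (simp_all add: map_remove_first[of snd "\<lambda>c. (_, c) \<in> G"])

lemma subseq_place: "subseq q q' \<Longrightarrow> subseq (place G i p q) (place G i p q')"
  by (cases i) (auto simp: subseq_remove_first)

definition located :: "(int \<Rightarrow> ('c, 's) item) \<Rightarrow> int \<Rightarrow> (int \<times> 'c) list \<Rightarrow> bool" where
  "located z N q \<longleftrightarrow> sorted_wrt (<) (map fst q) \<and> (\<forall>(m, c)\<in>set q. m \<le> N \<and> z m = Agent c)"

lemma set_remove_first_subset: "set (remove_first P q) \<subseteq> set q"
  by (induction q) auto

lemma located_place:
  assumes "located z N q"
  shows "located z (N + 1) (place G (z (N + 1)) (N + 1) q)"
proof (cases "z (N + 1)")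
  case (Agent c)
  then show ?thesis
    using assms by (fastforce simp: located_def sorted_wrt_append)
next
  case (Good s)
  let ?q = "remove_first (\<lambda>a. (s, snd a) \<in> G) q"
  have sub: "subseq ?q q" by (rule subseq_remove_first_self)
  then obtain I where "?q = nths q I" by (auto simp: subseq_conv_nths)
  then have "map fst ?q = nths (map fst q) I" by (simp add: nths_map)
  then have "sorted_wrt (<) (map fst ?q)"
    using assms by (simp add: located_def strict_sorted_iff sorted_nths distinct_nthsI)
  moreover have "set ?q \<subseteq> set q"
    by (rule set_remove_first_subset)
  moreover have "m \<le> N \<and> z m = Agent c" if "(m, c) \<in> set q" for m c
    using assms that by (auto simp: located_def)
  ultimately show ?thesis
    unfolding located_def Good place_simps by force
qed

text \<open>Sortedness by position is what makes the first compatible entry of the list the earliest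
  compatible agent.\<close>

lemma fst_set_remove_first:
  fixes q :: "('a::linorder \<times> 'b) list"
  assumes "sorted_wrt (<) (map fst q)"
  shows "fst ` set (remove_first P q) = fst ` set q -
    {m. \<exists>c. (m, c) \<in> set q \<and> P (m, c) \<and> (\<forall>k c'. (k, c') \<in> set q \<and> k < m \<longrightarrow> \<not> P (k, c'))}"
  using assms
proof (induction q)
  case (Cons a q)
  obtain p d where a: "a = (p, d)" by (cases a)
  have less: "p < m" if "(m, c) \<in> set q" for m c
    using Cons.prems that by (auto simp: a)
  have notin: "p \<notin> fst ` set q"
  proof
    assume "p \<in> fst ` set q"
    then obtain b where "(p, b) \<in> set q" by auto
    from less[OF this] show False by simp
  qed
  show ?case
  proof (cases "P a")
    case True
    have "{m. \<exists>c. (m, c) \<in> set (a # q) \<and> P (m, c) \<and> (\<forall>k c'. (k, c') \<in> set (a # q) \<and> k < m \<longrightarrow> \<not> P (k, c'))} = {p}"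
      using True less by (fastforce simp: a)
    then show ?thesis using True notin by (simp add: a)
  next
    case False
    have "{m. \<exists>c. (m, c) \<in> set (a # q) \<and> P (m, c) \<and> (\<forall>k c'. (k, c') \<in> set (a # q) \<and> k < m \<longrightarrow> \<not> P (k, c'))} =
      {m. \<exists>c. (m, c) \<in> set q \<and> P (m, c) \<and> (\<forall>k c'. (k, c') \<in> set q \<and> k < m \<longrightarrow> \<not> P (k, c'))}"
      using False by (auto simp: a)
    then show ?thesis
      using False Cons notin by (auto simp: a)
  qed
qed simp

section \<open>FCFS matchings described by their waiting sets\<close>

definition first_compatible ::
  "('s \<times> 'c) set \<Rightarrow> (int \<Rightarrow> ('c, 's) item) \<Rightarrow> 's \<Rightarrow> int set \<Rightarrow> int \<Rightarrow> bool" where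
  "first_compatible G z s W m \<longleftrightarrow> m \<in> W \<and> (\<exists>c. z m = Agent c \<and> (s, c) \<in> G) \<and>
     (\<forall>k\<in>W. \<forall>c. k < m \<and> z k = Agent c \<longrightarrow> (s, c) \<notin> G)"

lemma first_compatible_unique:
  "first_compatible G z s W m \<Longrightarrow> first_compatible G z s W m' \<Longrightarrow> m = m'"
  unfolding first_compatible_def by (metis linorder_neq_iff)

lemma fst_set_place_Good:
  assumes "located z N q"
  shows "fst ` set (place G (Good s) p q) =
    fst ` set q - {m. first_compatible G z s (fst ` set q) m}"
proof -
  define W where "W = fst ` set q"
  have agent: "z m = Agent c" if "(m, c) \<in> set q" for m c
    using assms that by (auto simp: located_def)
  have mem: "(m, c) \<in> set q \<longleftrightarrow> m \<in> W \<and> z m = Agent c" for m c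
  proof
    assume "m \<in> W \<and> z m = Agent c"
    then obtain d where "(m, d) \<in> set q" "z m = Agent c" by (auto simp: W_def)
    then show "(m, c) \<in> set q" using agent[of m d] by simp
  qed (use agent in \<open>force simp: W_def\<close>)
  have "fst ` set (place G (Good s) p q) = W -
      {m. \<exists>c. (m, c) \<in> set q \<and> (s, c) \<in> G \<and> (\<forall>k c'. (k, c') \<in> set q \<and> k < m \<longrightarrow> (s, c') \<notin> G)}"
    using assms fst_set_remove_first[of q "\<lambda>a. (s, snd a) \<in> G"] by (simp add: located_def W_def)
  also have "\<dots> = W - {m. first_compatible G z s W m}"
    unfolding mem first_compatible_def by blast
  finally show ?thesis by (simp add: W_def)
qed

lemma directed_fcfs_matchingD:
  assumes "directed_fcfs_matching G z A" "(n, m) \<in> A"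
  shows "m < n" "is_agent (z m)" "is_good (z n)"
proof -
  have "\<exists>s c. z n = Good s \<and> z m = Agent c \<and> m < n"
    using assms unfolding directed_fcfs_matching_def by metis
  then show "m < n" "is_agent (z m)" "is_good (z n)" by auto
qed

text \<open>\<open>U k\<close> stands for "the agent at \<open>k\<close> is matched before
  \<open>n\<close>". Keeping it abstract lets the same equivalence serve a given FCFS matching and a
  candidate not yet known to be one.\<close>

lemma first_compatible_iff:
  assumes W: "\<And>k. k \<in> W \<longleftrightarrow> k < n \<and> is_agent (z k) \<and> \<not> U k"
  shows "first_compatible G z s W m \<longleftrightarrow> (\<exists>c. z m = Agent c \<and> m < n \<and> (s, c) \<in> G \<and> \<not> U m \<and>
     (\<forall>k<m. \<forall>c'. z k = Agent c' \<and> (s, c') \<in> G \<longrightarrow> U k))" (is "?L \<longleftrightarrow> ?R")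
proof
  assume L: ?L
  then obtain c where c: "m \<in> W" "z m = Agent c" "(s, c) \<in> G" by (auto simp: first_compatible_def)
  have "U k" if k: "k < m" "z k = Agent c'" "(s, c') \<in> G" for k c'
  proof (rule ccontr)
    assume "\<not> U k"
    then have "k \<in> W" using k c(1) unfolding W by simp
    then show False using L k unfolding first_compatible_def by blast
  qed
  then show ?R using c unfolding W by blast
next
  assume R: ?R
  show ?L
    unfolding first_compatible_def
  proof (intro conjI ballI allI impI)
    show "m \<in> W" using R by (auto simp: W)
    show "\<exists>c. z m = Agent c \<and> (s, c) \<in> G" using R by blast
  next
    fix k c assume "k \<in> W" "k < m \<and> z k = Agent c"
    then show "(s, c) \<notin> G" using R W[of k] by blast
  qed
qed

lemma matched_iff_first_compatible:
  assumes "directed_fcfs_matching G z A"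
  shows "(n, m) \<in> A \<longleftrightarrow> (\<exists>s. z n = Good s \<and> first_compatible G z s (waiting z A (n - 1)) m)"
proof -
  have iff: "(n, m) \<in> A \<longleftrightarrow>
        (\<exists>s c. z n = Good s \<and> z m = Agent c \<and> m < n \<and> (s, c) \<in> G \<and>
           \<not> (\<exists>l<n. (l, m) \<in> A) \<and>
           (\<forall>k<m. \<forall>c'. z k = Agent c' \<and> (s, c') \<in> G \<longrightarrow> (\<exists>l<n. (l, k) \<in> A)))"
    using assms unfolding directed_fcfs_matching_def by blast
  have "k \<in> waiting z A (n - 1) \<longleftrightarrow> k < n \<and> is_agent (z k) \<and> \<not> (\<exists>l<n. (l, k) \<in> A)" for k
    by (auto simp: waiting_def)
  from first_compatible_iff[OF this] show ?thesis
    unfolding iff by blast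
qed

lemma waiting_Suc:
  assumes "directed_fcfs_matching G z A"
  shows "waiting z A (N + 1) =
    waiting z A N \<union> (if is_agent (z (N + 1)) then {N + 1} else {}) - {m. (N + 1, m) \<in> A}"
proof -
  have notin: "(n, N + 1) \<notin> A" if "n \<le> N" for n
    using directed_fcfs_matchingD(1)[OF assms, of n "N + 1"] that by auto
  have notin': "(N + 1, N + 1) \<notin> A"
    using directed_fcfs_matchingD(1)[OF assms, of "N + 1" "N + 1"] by auto
  have le: "n \<le> N + 1 \<longleftrightarrow> n \<le> N \<or> n = N + 1" for n :: int
    by auto
  show ?thesis
    unfolding waiting_def le using notin notin' by auto
qed

text \<open>From a known waiting set onwards, an FCFS matching has no freedom left.\<close>

lemma waiting_place:
  assumes A: "directed_fcfs_matching G z A" and q: "located z N q" "fst ` set q = waiting z A N"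
  shows "fst ` set (place G (z (N + 1)) (N + 1) q) = waiting z A (N + 1)"
proof (cases "z (N + 1)")
  case (Agent c)
  then have "(N + 1, m) \<notin> A" for m
    using directed_fcfs_matchingD(3)[OF A, of "N + 1" m] by auto
  then show ?thesis
    using Agent q by (auto simp: waiting_Suc[OF A])
next
  case (Good s)
  then have "{m. (N + 1, m) \<in> A} = {m. first_compatible G z s (waiting z A N) m}"
    by (simp add: matched_iff_first_compatible[OF A])
  then show ?thesis
    unfolding waiting_Suc[OF A] Good fst_set_place_Good[OF q(1)] q(2) by simp
qed

text \<open>An FCFS matching can be read off its waiting sets, so uniqueness only has to be shown
  for these.\<close>

lemma matched_iff_waiting:
  assumes "directed_fcfs_matching G z A"
  shows "(n, m) \<in> A \<longleftrightarrow> m \<in> waiting z A (n - 1) \<and> m \<notin> waiting z A n"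
proof
  assume nm: "(n, m) \<in> A"
  then have "m \<in> waiting z A (n - 1)"
    using matched_iff_first_compatible[OF assms, of n m] by (auto simp: first_compatible_def)
  then show "m \<in> waiting z A (n - 1) \<and> m \<notin> waiting z A n"
    using nm by (auto simp: waiting_def)
next
  assume w: "m \<in> waiting z A (n - 1) \<and> m \<notin> waiting z A n"
  then obtain n' where "n' \<le> n" "(n', m) \<in> A" by (auto simp: waiting_def)
  moreover have "\<not> n' \<le> n - 1" using w calculation(2) by (auto simp: waiting_def)
  ultimately show "(n, m) \<in> A" by (metis antisym_conv1 zle_diff1_eq)
qed

section \<open>Runs started empty and the epochs at which they have all emptied\<close>

primrec run :: "('s \<times> 'c) set \<Rightarrow> (int \<Rightarrow> ('c, 's) item) \<Rightarrow> int \<Rightarrow> nat \<Rightarrow> (int \<times> 'c) list" where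
  "run G z T 0 = []"
| "run G z T (Suc n) = place G (z (T + int n + 1)) (T + int n + 1) (run G z T n)"

text \<open>A run from \<open>T\<close> starts empty just after position \<open>T\<close>, so after
  \<open>n\<close> steps it has processed positions \<open>T + 1\<close> to \<open>T + n\<close> and
  describes time \<open>T + n\<close>.\<close>

lemma located_run: "located z (T + int n) (run G z T n)"
proof (induction n)
  case (Suc n)
  then show ?case using located_place[of z "T + int n" "run G z T n" G] by (simp add: add.commute add.left_commute)
qed (simp add: located_def)

lemma waiting_run:
  assumes "directed_fcfs_matching G z A" "waiting z A T = {}"
  shows "fst ` set (run G z T n) = waiting z A (T + int n)"
proof (induction n)
  case (Suc n)
  then show ?case
    using waiting_place[OF assms(1) located_run Suc] by (simp add: add.commute add.left_commute)
qed (simp add: assms)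

lemma run_add: "run G z T a = [] \<Longrightarrow> run G z T (a + b) = run G z (T + int a) b"
  by (induction b) (simp_all add: add.assoc)

text \<open>At time \<open>T + 1\<close> the later start has nobody waiting, and
  \<open>place\<close> preserves the subsequence relation thereafter.\<close>

lemma run_Suc_superseq: "subseq (run G z (T + 1) n) (run G z T (Suc n))"
proof (induction n)
  case (Suc n)
  then have "subseq (place G (z (T + 1 + int n + 1)) (T + 1 + int n + 1) (run G z (T + 1) n))
      (place G (z (T + 1 + int n + 1)) (T + 1 + int n + 1) (run G z T (Suc n)))"
    by (rule subseq_place)
  then show ?case by (simp add: add.commute add.left_commute)
qed simp

lemma run_cong: "(\<And>i. i \<le> T + int n \<Longrightarrow> z i = z' i) \<Longrightarrow> run G z T n = run G z' T n"
  by (induction n) auto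

text \<open>A regeneration epoch: every system started empty at or before \<open>N\<close> has
  nobody waiting at \<open>N\<close>.\<close>

definition emptied :: "('s \<times> 'c) set \<Rightarrow> (int \<Rightarrow> ('c, 's) item) \<Rightarrow> int \<Rightarrow> bool" where
  "emptied G z N \<longleftrightarrow> (\<forall>k. run G z (N - int k) k = [])"

definition recurrent_past :: "('s \<times> 'c) set \<Rightarrow> (int \<Rightarrow> ('c, 's) item) \<Rightarrow> bool" where
  "recurrent_past G z \<longleftrightarrow> (\<forall>N. \<exists>k. emptied G z (N - int k))"

definition recurrent_future :: "('s \<times> 'c) set \<Rightarrow> (int \<Rightarrow> ('c, 's) item) \<Rightarrow> bool" where
  "recurrent_future G z \<longleftrightarrow> (\<forall>N. \<exists>k. emptied G z (N + int k))"

text \<open>The state of the stationary system: the common value of all runs from before an epoch at which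
  every earlier start has emptied.\<close>

definition queue :: "('s \<times> 'c) set \<Rightarrow> (int \<Rightarrow> ('c, 's) item) \<Rightarrow> int \<Rightarrow> (int \<times> 'c) list" where
  "queue G z N = (let k = LEAST k. emptied G z (N - int k) in run G z (N - int k) k)"

text \<open>Every earlier start has nobody waiting at \<open>N - k\<close> and from there on repeats
  the run started at that epoch.\<close>

lemma run_emptied:
  assumes "emptied G z (N - int k)" "k \<le> j"
  shows "run G z (N - int j) j = run G z (N - int k) k"
proof -
  have "run G z (N - int k - int (j - k)) (j - k) = []"
    using assms(1) unfolding emptied_def by blast
  then have "run G z (N - int j) (j - k) = []" using assms(2) by (simp add: of_nat_diff)
  from run_add[OF this, of k] show ?thesis using assms(2) by (simp add: of_nat_diff)
qed

lemma queue_eq_run: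
  assumes "emptied G z (N - int k)" "k \<le> j"
  shows "queue G z N = run G z (N - int j) j"
proof -
  define l where "l = (LEAST k. emptied G z (N - int k))"
  have "emptied G z (N - int l)" "l \<le> k"
    unfolding l_def using assms(1) by (rule LeastI, rule Least_le)
  then have "run G z (N - int j) j = run G z (N - int l) l"
    using assms(2) by (intro run_emptied) auto
  then show ?thesis by (simp add: queue_def l_def Let_def)
qed

lemma queue_emptied: "emptied G z N \<Longrightarrow> queue G z N = []"
  using queue_eq_run[of G z N 0 0] by simp

section \<open>Existence and uniqueness of the perfect matching on a recurrent path\<close>

context
  fixes G :: "('s \<times> 'c) set" and z :: "int \<Rightarrow> ('c, 's) item"
  assumes past: "recurrent_past G z"
begin

lemma queue_Suc: "queue G z (N + 1) = place G (z (N + 1)) (N + 1) (queue G z N)"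
proof -
  obtain k where k: "emptied G z (N - int k)" using past unfolding recurrent_past_def by blast
  then have "emptied G z (N + 1 - int (Suc k))" by simp
  then have "queue G z (N + 1) = run G z (N + 1 - int (Suc k)) (Suc k)" by (rule queue_eq_run) simp
  then show ?thesis using queue_eq_run[OF k order.refl] by simp
qed

lemma located_queue: "located z N (queue G z N)"
proof -
  obtain k where k: "emptied G z (N - int k)" using past unfolding recurrent_past_def by blast
  show ?thesis
    using located_run[of z "N - int k" k G] queue_eq_run[OF k order.refl] by simp
qed

text \<open>The requirement of empty epochs arbitrarily far back supplies one, \<open>T\<close>,
  before a regeneration epoch. From \<open>T\<close> on the matching follows a finite run, which no
  longer depends on \<open>T\<close>.\<close>

lemma perfect_waiting_eq:
  assumes "perfect_fcfs_matching G z A"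
  shows "waiting z A N = fst ` set (queue G z N)"
proof -
  obtain k where k: "emptied G z (N - int k)" using past unfolding recurrent_past_def by blast
  obtain T where T: "T \<le> N - int k" "waiting z A T = {}"
    using assms unfolding perfect_fcfs_matching_def by blast
  define j where "j = nat (N - T)"
  have j: "T = N - int j" "k \<le> j" using T(1) by (auto simp: j_def)
  then have "fst ` set (run G z T j) = waiting z A (T + int j)"
    using waiting_run[OF _ T(2)] assms unfolding perfect_fcfs_matching_def by blast
  then show ?thesis using queue_eq_run[OF k j(2)] j by simp
qed

text \<open>The only candidate, by \<open>matched_iff_waiting\<close>, once the waiting sets are
  known to be the queues.\<close>

definition queue_matching :: "(int \<times> int) set" where
  "queue_matching = {(n, m). m \<in> fst ` set (queue G z (n - 1)) \<and> m \<notin> fst ` set (queue G z n)}"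

lemma queue_matching_iff:
  "(n, m) \<in> queue_matching \<longleftrightarrow> (\<exists>s. z n = Good s \<and> first_compatible G z s (fst ` set (queue G z (n - 1))) m)"
proof (cases "z n")
  case (Agent c)
  then show ?thesis
    using queue_Suc[of "n - 1"] by (auto simp: queue_matching_def)
next
  case (Good s)
  have "fst ` set (queue G z n) = fst ` set (queue G z (n - 1)) -
      {m. first_compatible G z s (fst ` set (queue G z (n - 1))) m}"
    using queue_Suc[of "n - 1"] fst_set_place_Good[OF located_queue, of G s n "n - 1"] Good by simp
  then show ?thesis
    using Good by (auto simp: queue_matching_def first_compatible_def)
qed

lemma queue_positions: "m \<in> fst ` set (queue G z N) \<Longrightarrow> m \<le> N \<and> is_agent (z m)"
  using located_queue[of N] by (fastforce simp: located_def)

lemma queue_left: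
  assumes "m \<notin> fst ` set (queue G z n)" "m \<le> n" "n \<le> n'"
  shows "m \<notin> fst ` set (queue G z n')"
  using assms(3)
proof (induction n' rule: int_ge_induct)
  case (step i)
  show ?case
  proof (cases "z (i + 1)")
    case (Agent c)
    then show ?thesis using step assms(2) by (auto simp: queue_Suc)
  next
    case (Good s)
    then show ?thesis
      using step fst_set_place_Good[OF located_queue, of G s "i + 1" i] by (simp add: queue_Suc)
  qed
qed (fact assms(1))

lemma waiting_queue_matching: "waiting z queue_matching N = fst ` set (queue G z N)"
proof (intro equalityI subsetI)
  fix m assume m: "m \<in> waiting z queue_matching N"
  then obtain c where c: "z m = Agent c" by (auto simp: waiting_def is_agent_def)
  have "m \<le> n \<Longrightarrow> n \<le> N \<Longrightarrow> m \<in> fst ` set (queue G z n)" for n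
  proof (induction n rule: int_ge_induct)
    case base
    then show ?case using queue_Suc[of "m - 1"] c by simp
  next
    case (step i)
    then have "(i + 1, m) \<notin> queue_matching" using m by (auto simp: waiting_def)
    then show ?case using step by (auto simp: queue_matching_def)
  qed
  then show "m \<in> fst ` set (queue G z N)" using m by (auto simp: waiting_def)
next
  fix m assume m: "m \<in> fst ` set (queue G z N)"
  have "(n, m) \<notin> queue_matching" if "n \<le> N" for n
  proof
    assume "(n, m) \<in> queue_matching"
    then have "m \<le> n - 1" "m \<notin> fst ` set (queue G z n)"
      using queue_positions[of m "n - 1"] by (auto simp: queue_matching_def)
    then show False using queue_left[of m n N] m that by simp
  qed
  then show "m \<in> waiting z queue_matching N"
    using queue_positions[OF m] by (auto simp: waiting_def)
qed

lemma directed_queue_matching: "directed_fcfs_matching G z queue_matching"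
  unfolding directed_fcfs_matching_def
proof (intro conjI allI)
  show "single_valued queue_matching"
    by (auto simp: single_valued_def queue_matching_iff intro: first_compatible_unique)
  have False if "(n, m) \<in> queue_matching" "(n', m) \<in> queue_matching" "n < n'" for n n' m
  proof -
    have "m \<notin> fst ` set (queue G z n)" "m \<le> n - 1" "m \<in> fst ` set (queue G z (n' - 1))"
      using that queue_positions[of m "n - 1"] by (auto simp: queue_matching_def)
    then show False using queue_left[of m n "n' - 1"] that(3) by simp
  qed
  then show "single_valued (queue_matching\<inverse>)"
    unfolding single_valued_def by (metis converse_iff linorder_neq_iff)
  fix n m
  have "k \<in> fst ` set (queue G z (n - 1)) \<longleftrightarrow>
      k < n \<and> is_agent (z k) \<and> \<not> (\<exists>l<n. (l, k) \<in> queue_matching)" for k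
    unfolding waiting_queue_matching[symmetric] by (auto simp: waiting_def)
  from first_compatible_iff[OF this] show "(n, m) \<in> queue_matching \<longleftrightarrow>
        (\<exists>s c. z n = Good s \<and> z m = Agent c \<and> m < n \<and> (s, c) \<in> G \<and>
           \<not> (\<exists>l<n. (l, m) \<in> queue_matching) \<and>
           (\<forall>k<m. \<forall>c'. z k = Agent c' \<and> (s, c') \<in> G \<longrightarrow> (\<exists>l<n. (l, k) \<in> queue_matching)))"
    unfolding queue_matching_iff[of n m] by blast
qed

text \<open>Regeneration in the future gets every agent matched; regeneration in the past yields the
  empty epochs.\<close>

lemma perfect_queue_matching:
  assumes "recurrent_future G z"
  shows "perfect_fcfs_matching G z queue_matching"
  unfolding perfect_fcfs_matching_def
proof (intro conjI allI directed_queue_matching)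
  show "all_agents_matched z queue_matching"
    unfolding all_agents_matched_def
  proof (intro allI impI)
    fix m assume "is_agent (z m)"
    obtain k where "emptied G z (m + int k)"
      using assms unfolding recurrent_future_def by blast
    then have "waiting z queue_matching (m + int k) = {}"
      by (simp add: waiting_queue_matching queue_emptied)
    then show "\<exists>n. (n, m) \<in> queue_matching"
      using \<open>is_agent (z m)\<close> by (auto simp: waiting_def)
  qed
  fix N
  obtain k where "emptied G z (N - int k)" using past unfolding recurrent_past_def by blast
  then show "\<exists>N'\<le>N. waiting z queue_matching N' = {}"
    by (intro exI[of _ "N - int k"]) (simp add: waiting_queue_matching queue_emptied)
qed

lemma perfect_fcfs_matching_unique:
  assumes "perfect_fcfs_matching G z A" "perfect_fcfs_matching G z A'"
  shows "A = A'"
proof -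
  have "waiting z A = waiting z A'"
    using assms by (simp add: fun_eq_iff perfect_waiting_eq)
  then have "(n, m) \<in> A \<longleftrightarrow> (n, m) \<in> A'" for n m
    using assms matched_iff_waiting[of G z] unfolding perfect_fcfs_matching_def by metis
  then show ?thesis by auto
qed

lemma ex1_perfect_fcfs_matching:
  assumes "recurrent_future G z"
  shows "\<exists>!A. perfect_fcfs_matching G z A"
  using perfect_queue_matching[OF assms] perfect_fcfs_matching_unique by blast

lemma X_state_eq_queue:
  assumes "recurrent_future G z"
  shows "X_state G z N = map snd (queue G z N)"
proof -
  have "perfect_fcfs_matching G z (fcfs_matching G z)"
    unfolding fcfs_matching_def by (rule theI'[OF ex1_perfect_fcfs_matching[OF assms]])
  then have "waiting z (fcfs_matching G z) N = set (map fst (queue G z N))"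
    by (simp add: perfect_waiting_eq)
  moreover have "sorted_list_of_set (set (map fst (queue G z N))) = map fst (queue G z N)"
    using located_queue[of N]
    by (intro sorted_list_of_set.idem_if_sorted_distinct) (auto simp: located_def strict_sorted_iff)
  ultimately have "X_state G z N = map (\<lambda>m. agent_type (z m)) (map fst (queue G z N))"
    unfolding X_state_def by presburger
  also have "\<dots> = map snd (queue G z N)"
    using located_queue[of N] by (auto simp: located_def)
  finally show ?thesis .
qed

end

subsection \<open>Measurability of the queue\<close>

abbreviation paths :: "(int \<Rightarrow> ('c, 's) item) measure" where
  "paths \<equiv> PiM UNIV (\<lambda>_. count_space UNIV)"

lemma measurable_run [measurable]:
  "(\<lambda>z. run G z T n) \<in> (paths :: (int \<Rightarrow> ('c::finite, 's::finite) item) measure) \<rightarrow>\<^sub>M count_space UNIV"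
proof (induction n)
  case (Suc n)
  have coord: "(\<lambda>z. z p) \<in> (paths :: (int \<Rightarrow> ('c, 's) item) measure) \<rightarrow>\<^sub>M count_space UNIV" for p
    by (rule measurable_component_singleton) simp
  have "(\<lambda>z. place G (z p) p q) \<in> (paths :: (int \<Rightarrow> ('c, 's) item) measure) \<rightarrow>\<^sub>M count_space UNIV" for p q
    by (rule measurable_compose[OF coord]) simp
  then show ?case
    using measurable_compose_countable[OF _ Suc, of "\<lambda>q z. place G (z (T + int n + 1)) (T + int n + 1) q"]
    by simp
qed simp

lemma measurable_emptied [measurable]:
  "Measurable.pred (paths :: (int \<Rightarrow> ('c::finite, 's::finite) item) measure) (\<lambda>z. emptied G z N)"
  unfolding emptied_def by measurable

lemma measurable_queue [measurable]:
  "(\<lambda>z. queue G z N) \<in> (paths :: (int \<Rightarrow> ('c::finite, 's::finite) item) measure) \<rightarrow>\<^sub>M count_space UNIV"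
  unfolding queue_def Let_def
  by (rule measurable_compose_countable[where f = "\<lambda>k z. run G z (N - int k) k"]) measurable

text \<open>Dependence on the items up to \<open>N\<close>, phrased as invariance: a path may be
  truncated at \<open>N\<close> with arbitrary values beyond, which reduces the event to the
  sigma-algebra of the remaining items.\<close>

definition past_event :: "int \<Rightarrow> ((int \<Rightarrow> ('c, 's) item) \<Rightarrow> bool) \<Rightarrow> bool" where
  "past_event N P \<longleftrightarrow> Measurable.pred paths P \<and> (\<forall>z z'. (\<forall>i\<le>N. z i = z' i) \<longrightarrow> P z = P z')"

lemma emptied_cong: "(\<And>i. i \<le> N \<Longrightarrow> z i = z' i) \<Longrightarrow> emptied G z N = emptied G z' N"
  unfolding emptied_def using run_cong[of "N - int k" k z z' G for k] by simp

lemma queue_cong: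
  assumes "\<And>i. i \<le> N \<Longrightarrow> z i = z' i"
  shows "queue G z N = queue G z' N"
proof -
  have "emptied G z (N - int k) = emptied G z' (N - int k)" for k
    by (rule emptied_cong) (simp add: assms)
  moreover have "run G z (N - int k) k = run G z' (N - int k) k" for k
    by (rule run_cong) (simp add: assms)
  ultimately show ?thesis by (simp add: queue_def)
qed

lemma past_event_queues:
  "past_event N (\<lambda>z :: int \<Rightarrow> ('c::finite, 's::finite) item. \<forall>i\<le>n. Q i (queue G z (N - int i)))"
  unfolding past_event_def
proof (intro conjI allI impI)
  fix z z' :: "int \<Rightarrow> ('c, 's) item" assume "\<forall>i\<le>N. z i = z' i"
  then have "queue G z (N - int i) = queue G z' (N - int i)" for i
    by (intro queue_cong) simp
  then show "(\<forall>i\<le>n. Q i (queue G z (N - int i))) = (\<forall>i\<le>n. Q i (queue G z' (N - int i)))"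
    by simp
qed measurable

text \<open>This holds for every \<open>N\<close>, because the starting epochs may be lowered at
  will; it makes recurrence a tail event of the time-reversed sequence.\<close>

lemma past_event_recurrent_past:
  "past_event N (recurrent_past G :: (int \<Rightarrow> ('c::finite, 's::finite) item) \<Rightarrow> bool)"
  unfolding past_event_def
proof (intro conjI allI impI)
  show "Measurable.pred paths (recurrent_past G :: (int \<Rightarrow> ('c, 's) item) \<Rightarrow> bool)"
    unfolding recurrent_past_def[abs_def] by measurable
  fix z z' :: "int \<Rightarrow> ('c, 's) item" assume eq: "\<forall>i\<le>N. z i = z' i"
  have *: "recurrent_past G z \<longleftrightarrow> (\<forall>M\<le>N. \<exists>k. emptied G z (M - int k))" for z :: "int \<Rightarrow> ('c, 's) item"
  proof
    assume R: "\<forall>M\<le>N. \<exists>k. emptied G z (M - int k)"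
    show "recurrent_past G z"
      unfolding recurrent_past_def
    proof
      fix M
      obtain k where "emptied G z (min M N - int k)" using R[rule_format, of "min M N"] by auto
      moreover have "min M N - int k = M - int (nat (M - min M N) + k)" by simp
      ultimately show "\<exists>k. emptied G z (M - int k)" by metis
    qed
  qed (simp add: recurrent_past_def)
  have "emptied G z (M - int k) = emptied G z' (M - int k)" if "M \<le> N" for M k
    using eq that by (intro emptied_cong) simp
  then show "recurrent_past G z = recurrent_past G z'"
    unfolding * by blast
qed

text \<open>A shift of the path also moves the recorded positions, so only the types can
  agree.\<close>

lemma map_snd_run_shift: "map snd (run G (\<lambda>n. z (n + d)) T n) = map snd (run G z (T + d) n)"
  by (induction n) (simp_all add: map_snd_place add.commute add.left_commute)

lemma emptied_shift: "emptied G (\<lambda>n. z (n + d)) N = emptied G z (N + d)"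
proof -
  have "run G (\<lambda>n. z (n + d)) (N - int k) k = [] \<longleftrightarrow> run G z (N + d - int k) k = []" for k
    using arg_cong[OF map_snd_run_shift[of G z d "N - int k" k], of "\<lambda>x. x = []"]
    by (simp add: algebra_simps)
  then show ?thesis by (simp add: emptied_def)
qed

lemma map_snd_queue_shift:
  "map snd (queue G (\<lambda>n. z (n + d)) N) = map snd (queue G z (N + d))"
proof -
  have "emptied G (\<lambda>n. z (n + d)) (N - int k) = emptied G z (N + d - int k)" for k
    by (simp add: emptied_shift algebra_simps)
  moreover have "map snd (run G (\<lambda>n. z (n + d)) (N - int k) k) = map snd (run G z (N + d - int k) k)" for k
    using map_snd_run_shift[of G z d "N - int k" k] by (simp add: algebra_simps)
  ultimately show ?thesis by (simp add: queue_def Let_def)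
qed

subsection \<open>The matching process\<close>

lemma (in prob_space) indep_sets_reindex:
  assumes "indep_sets F UNIV" "inj h"
  shows "indep_sets (\<lambda>i. F (h i)) UNIV"
proof (rule indep_setsI)
  show "F (h i) \<subseteq> events" for i
    using assms(1) by (simp add: indep_sets_def)
  fix A J assume J: "J \<noteq> {}" "finite J" "\<forall>j\<in>J. A j \<in> F (h j)"
  have inv: "inv h (h j) = j" for j by (rule inv_f_f[OF assms(2)])
  have "prob (\<Inter>j\<in>h ` J. A (inv h j)) = (\<Prod>j\<in>h ` J. prob (A (inv h j)))"
    using J by (intro indep_setsD[OF assms(1)]) (auto simp: inv)
  then show "prob (\<Inter>j\<in>J. A j) = (\<Prod>j\<in>J. prob (A j))"
    using assms(2) by (simp add: inv prod.reindex inj_on_subset[of h UNIV])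
qed

lemma (in prob_space) pmf_of_random_variable:
  fixes X :: "'a \<Rightarrow> 'b::countable"
  assumes X[measurable]: "X \<in> M \<rightarrow>\<^sub>M count_space UNIV"
  shows "\<exists>p. \<forall>A. measure (measure_pmf p) A = prob {\<omega> \<in> space M. X \<omega> \<in> A}"
proof -
  define D where "D = distr M (count_space UNIV) X"
  interpret D: prob_space D unfolding D_def by (rule prob_space_distr) simp
  have [simp]: "sets D = UNIV" "space D = UNIV" by (simp_all add: D_def)
  have "emeasure D {x. measure D {x} = 0} = 0"
    by (subst emeasure_countable_singleton)
      (auto simp: D.emeasure_eq_measure nn_integral_0_iff_AE AE_count_space)
  then have "AE x in D. measure D {x} \<noteq> 0"
    by (subst AE_iff_measurable[OF _ refl]) auto
  then have "measure_pmf (Abs_pmf D) = D"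
    by (intro Abs_pmf_inverse) (simp add: D.prob_space_axioms)
  then have "measure (measure_pmf (Abs_pmf D)) A = prob {\<omega> \<in> space M. X \<omega> \<in> A}" for A
    by (simp add: D_def measure_distr vimage_def Int_def conj_commute)
  then show ?thesis by blast
qed

locale matching_process = matching_rates G lam mu + prob_space M
  for G :: "('s::finite \<times> 'c::finite) set" and lam mu and M :: "'w measure" +
  fixes z :: "int \<Rightarrow> 'w \<Rightarrow> ('c, 's) item"
  assumes indep: "indep_vars (\<lambda>_. count_space UNIV) z UNIV"
    and law: "prob {\<omega> \<in> space M. z n \<omega> = i} = rate i / total_rate"
begin

lemma measurable_item [measurable]: "z n \<in> M \<rightarrow>\<^sub>M count_space UNIV"
  using indep by (simp add: indep_vars_def2)

lemma measurable_path [measurable]: "(\<lambda>\<omega> n. z n \<omega>) \<in> M \<rightarrow>\<^sub>M paths"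
  by (rule measurable_abs_UNIV) simp

lemma path_event: "Measurable.pred paths P \<Longrightarrow> {\<omega> \<in> space M. P (\<lambda>n. z n \<omega>)} \<in> events"
  using measurable_compose[OF measurable_path, of P] by simp

lemma next_item_indep:
  assumes "past_event N P"
  shows "prob {\<omega> \<in> space M. P (\<lambda>n. z n \<omega>) \<and> z (N + 1) \<omega> = i} =
    prob {\<omega> \<in> space M. P (\<lambda>n. z n \<omega>)} * (rate i / total_rate)"
proof -
  let ?C = "\<lambda>_ :: int. count_space UNIV :: ('c, 's) item measure" and ?X = "\<lambda>\<omega>. restrict (\<lambda>n. z n \<omega>)"
  let ?L = "PiM {..N} ?C" and ?R = "PiM {N + 1} ?C"
  \<comment> \<open>Restriction makes the coordinates beyond \<open>N\<close> undefined, and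
    \<open>P\<close> does not look at them.\<close>
  have P: "Measurable.pred paths P" "P (?X \<omega> {..N}) = P (\<lambda>n. z n \<omega>)" for \<omega>
    using assms unfolding past_event_def by auto
  have "(\<lambda>x n. x n) \<in> ?L \<rightarrow>\<^sub>M paths"
  proof (rule measurable_abs_UNIV)
    fix n
    show "(\<lambda>x. x n) \<in> ?L \<rightarrow>\<^sub>M count_space UNIV"
    proof (cases "n \<le> N")
      case False
      have "(\<lambda>x. x n) \<in> ?L \<rightarrow>\<^sub>M count_space UNIV \<longleftrightarrow> (\<lambda>x. undefined) \<in> ?L \<rightarrow>\<^sub>M (count_space UNIV :: ('c, 's) item measure)"
        using False by (intro measurable_cong) (auto simp: space_PiM PiE_def extensional_def)
      then show ?thesis by simp
    qed simp
  qed
  then have A: "{x \<in> space ?L. P x} \<in> sets ?L"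
    using measurable_compose[OF _ P(1), of "\<lambda>x. x" ?L] by simp
  have B: "{x \<in> space ?R. x (N + 1) = i} \<in> sets ?R"
    by measurable
  have "indep_var ?L (\<lambda>\<omega>. ?X \<omega> {..N}) ?R (\<lambda>\<omega>. ?X \<omega> {N + 1})"
    by (rule indep_var_restrict[OF indep]) auto
  from indep_varD[OF this A B]
  have "prob ((\<lambda>\<omega>. (?X \<omega> {..N}, ?X \<omega> {N + 1})) -` ({x \<in> space ?L. P x} \<times> {x \<in> space ?R. x (N + 1) = i}) \<inter> space M)
     = prob ((\<lambda>\<omega>. ?X \<omega> {..N}) -` {x \<in> space ?L. P x} \<inter> space M) *
       prob ((\<lambda>\<omega>. ?X \<omega> {N + 1}) -` {x \<in> space ?R. x (N + 1) = i} \<inter> space M)" .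
  moreover have "(\<lambda>\<omega>. (?X \<omega> {..N}, ?X \<omega> {N + 1})) -` ({x \<in> space ?L. P x} \<times> {x \<in> space ?R. x (N + 1) = i}) \<inter> space M =
      {\<omega> \<in> space M. P (\<lambda>n. z n \<omega>) \<and> z (N + 1) \<omega> = i}"
    by (auto simp: P(2) space_PiM)
  moreover have "(\<lambda>\<omega>. ?X \<omega> {..N}) -` {x \<in> space ?L. P x} \<inter> space M = {\<omega> \<in> space M. P (\<lambda>n. z n \<omega>)}"
    by (auto simp: P(2) space_PiM)
  moreover have "(\<lambda>\<omega>. ?X \<omega> {N + 1}) -` {x \<in> space ?R. x (N + 1) = i} \<inter> space M = {\<omega> \<in> space M. z (N + 1) \<omega> = i}"
    by (auto simp: space_PiM)
  ultimately show ?thesis by (simp add: law)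
qed

lemma prob_next_item:
  assumes "\<And>i. past_event N (P i)"
  shows "prob {\<omega> \<in> space M. P (z (N + 1) \<omega>) (\<lambda>n. z n \<omega>)} =
    (\<Sum>i\<in>UNIV. rate i / total_rate * prob {\<omega> \<in> space M. P i (\<lambda>n. z n \<omega>)})"
proof -
  have [measurable]: "Measurable.pred paths (P i)" for i
    using assms by (simp add: past_event_def)
  let ?A = "\<lambda>i. {\<omega> \<in> space M. P i (\<lambda>n. z n \<omega>) \<and> z (N + 1) \<omega> = i}"
  have "{\<omega> \<in> space M. P (z (N + 1) \<omega>) (\<lambda>n. z n \<omega>)} = (\<Union>i. ?A i)"
    by auto
  moreover have "prob (\<Union>i. ?A i) = (\<Sum>i\<in>UNIV. prob (?A i))"
    by (rule finite_measure_finite_Union) (auto simp: disjoint_family_on_def)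
  ultimately show ?thesis
    by (simp add: next_item_indep[OF assms] mult.commute)
qed

lemma prob_shift:
  assumes "Measurable.pred paths P"
  shows "prob {\<omega> \<in> space M. P (\<lambda>n. z (n + d) \<omega>)} = prob {\<omega> \<in> space M. P (\<lambda>n. z n \<omega>)}"
proof -
  let ?C = "\<lambda>_ :: int. count_space UNIV :: ('c, 's) item measure"
  have "indep_vars ?C (\<lambda>n. z (n + d)) UNIV"
    using indep indep_sets_reindex[of "\<lambda>i. {z i -` A \<inter> space M | A. A \<in> sets (count_space UNIV)}" "\<lambda>n. n + d"]
    by (simp add: indep_vars_def2)
  then have "distr M paths (\<lambda>\<omega> n. z (n + d) \<omega>) = PiM UNIV (\<lambda>n. distr M (count_space UNIV) (z (n + d)))"
    by (subst (asm) indep_vars_iff_distr_eq_PiM) (auto simp: restrict_UNIV)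
  moreover have "distr M paths (\<lambda>\<omega> n. z n \<omega>) = PiM UNIV (\<lambda>n. distr M (count_space UNIV) (z n))"
    using indep by (subst (asm) indep_vars_iff_distr_eq_PiM) (auto simp: restrict_UNIV)
  moreover have "distr M (count_space UNIV) (z (n + d)) = distr M (count_space UNIV) (z n)" for n
  proof (rule measure_eqI_countable[of _ UNIV])
    fix i
    have "emeasure M (z n -` {i} \<inter> space M) = ennreal (rate i / total_rate)" for n
      using law[of n i] by (simp add: emeasure_eq_measure vimage_def Int_def conj_commute)
    then show "emeasure (distr M (count_space UNIV) (z (n + d))) {i} = emeasure (distr M (count_space UNIV) (z n)) {i}"
      by (simp add: emeasure_distr)
  qed auto
  ultimately have eq: "distr M paths (\<lambda>\<omega> n. z (n + d) \<omega>) = distr M paths (\<lambda>\<omega> n. z n \<omega>)"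
    by simp
  have "{x. P x} \<in> sets paths"
    using assms by (simp add: space_PiM pred_def)
  moreover have "(\<lambda>\<omega> n. z (n + d) \<omega>) \<in> M \<rightarrow>\<^sub>M paths"
    by (rule measurable_abs_UNIV) simp
  ultimately show ?thesis
    using arg_cong[OF eq, of "\<lambda>D. measure D {x. P x}"]
    by (simp add: measure_distr vimage_def Int_def conj_commute)
qed

subsection \<open>Recurrence of the empty state\<close>

lemma law_run: "prob {\<omega> \<in> space M. map snd (run G (\<lambda>n. z n \<omega>) T n) \<in> A} = measure (queue_kernel_power n []) A"
proof (induction n arbitrary: A)
  case (Suc n)
  let ?P = "\<lambda>i z. step G i (map snd (run G z T n)) \<in> A"
  have past: "past_event (T + int n) (?P i)" for i
    unfolding past_event_def
  proof (intro conjI allI impI)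
    fix z z' :: "int \<Rightarrow> ('c, 's) item" assume "\<forall>i\<le>T + int n. z i = z' i"
    then have "run G z T n = run G z' T n" by (intro run_cong) simp
    then show "?P i z = ?P i z'" by simp
  qed measurable
  have "prob {\<omega> \<in> space M. map snd (run G (\<lambda>n. z n \<omega>) T (Suc n)) \<in> A} =
      prob {\<omega> \<in> space M. ?P (z (T + int n + 1) \<omega>) (\<lambda>n. z n \<omega>)}"
    by (simp add: map_snd_place)
  also have "\<dots> = (\<Sum>i\<in>UNIV. rate i / total_rate * prob {\<omega> \<in> space M. ?P i (\<lambda>n. z n \<omega>)})"
    by (rule prob_next_item[OF past])
  also have "\<dots> = measure (queue_kernel_power (Suc n) []) A"
    using Suc[of "{x. step G i x \<in> A}" for i] by (simp add: measure_bind_kernel)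
  finally show ?case .
qed (simp add: prob_space indicator_def)

text \<open>Emptiness at \<open>N\<close> for an earlier start implies it for a later one. The
  events are thus nested, and the bound for each single start passes to their intersection.\<close>

lemma prob_emptied_ge: "prob {\<omega> \<in> space M. emptied G (\<lambda>n. z n \<omega>) N} \<ge> pmf queue_pmf []"
proof -
  let ?E = "\<lambda>k. {\<omega> \<in> space M. run G (\<lambda>n. z n \<omega>) (N - int k) k = []}"
  have "?E (Suc k) \<subseteq> ?E k" for k
  proof
    fix \<omega> assume \<omega>: "\<omega> \<in> ?E (Suc k)"
    have "subseq (run G (\<lambda>n. z n \<omega>) (N - int k) k) (run G (\<lambda>n. z n \<omega>) (N - int (Suc k)) (Suc k))"
      using run_Suc_superseq[of G "\<lambda>n. z n \<omega>" "N - int (Suc k)" k] by simp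
    then show "\<omega> \<in> ?E k" using \<omega> by (simp del: run.simps)
  qed
  then have "decseq ?E" by (rule decseq_SucI)
  moreover have "?E k \<in> events" for k
    by (rule path_event) measurable
  ultimately have "(\<lambda>k. prob (?E k)) \<longlonglongrightarrow> prob (\<Inter>k. ?E k)"
    by (intro finite_Lim_measure_decseq) auto
  moreover have "(\<Inter>k. ?E k) = {\<omega> \<in> space M. emptied G (\<lambda>n. z n \<omega>) N}"
    by (auto simp: emptied_def)
  moreover have "pmf queue_pmf [] \<le> prob (?E k)" for k
    using law_run[of "N - int k" k "{[]}"] queue_kernel_power_empty_ge[of k]
    by (simp add: measure_pmf_single)
  ultimately show ?thesis
    by (metis (no_types, lifting) LIMSEQ_le_const)
qed

lemma past_event_in_tail:
  assumes "past_event (- int n) P"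
  shows "{\<omega> \<in> space M. P (\<lambda>n. z n \<omega>)} \<in>
    sigma_sets (space M) (\<Union>i\<in>{n..}. sigma_sets (space M) {z (- int i) -` S \<inter> space M | S. S \<in> UNIV})"
proof -
  let ?A = "\<lambda>i. sigma_sets (space M) {z (- int i) -` S \<inter> space M | S. S \<in> UNIV}"
  define \<Sigma> where "\<Sigma> = sigma (space M) (\<Union>i\<in>{n..}. ?A i)"
  have "?A i \<subseteq> Pow (space M)" for i
    using sigma_sets_into_sp[of "{z (- int i) -` S \<inter> space M | S. S \<in> UNIV}" "space M"] by auto
  then have \<Sigma>: "space \<Sigma> = space M" "sets \<Sigma> = sigma_sets (space M) (\<Union>i\<in>{n..}. ?A i)"
    unfolding \<Sigma>_def by (auto simp: sets_measure_of_conv UN_subset_iff)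
  \<comment> \<open>The path truncated at \<open>- n\<close> is measurable for the later
    sigma-algebras of the reversed sequence, and \<open>P\<close> cannot distinguish it from the
    full path.\<close>
  let ?f = "\<lambda>\<omega> j. if j \<le> - int n then z j \<omega> else undefined"
  have "?f \<in> \<Sigma> \<rightarrow>\<^sub>M paths"
  proof (rule measurable_abs_UNIV)
    fix j
    show "(\<lambda>\<omega>. if j \<le> - int n then z j \<omega> else undefined) \<in> \<Sigma> \<rightarrow>\<^sub>M count_space UNIV"
    proof (cases "j \<le> - int n")
      case True
      have "z j -` S \<inter> space M \<in> sets \<Sigma>" for S
      proof -
        define i where "i = nat (- j)"
        have i: "- int i = j" "i \<in> {n..}" using True by (auto simp: i_def)
        have "z (- int i) -` S \<inter> space M \<in> ?A i" by (rule sigma_sets.Basic) blast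
        with i(2) have "z (- int i) -` S \<inter> space M \<in> (\<Union>i\<in>{n..}. ?A i)" by (rule UN_I)
        then have "z j -` S \<inter> space M \<in> (\<Union>i\<in>{n..}. ?A i)" by (simp only: i(1))
        then show ?thesis unfolding \<Sigma> by (rule sigma_sets.Basic)
      qed
      then show ?thesis using True by (auto simp: measurable_def \<Sigma>(1))
    qed simp
  qed
  moreover have "{x. P x} \<in> sets paths"
    using assms by (simp add: space_PiM pred_def past_event_def)
  ultimately have "?f -` {x. P x} \<inter> space \<Sigma> \<in> sets \<Sigma>" by (rule measurable_sets)
  moreover have "P (?f \<omega>) = P (\<lambda>n. z n \<omega>)" for \<omega>
    using assms unfolding past_event_def by auto
  ultimately show ?thesis by (simp add: \<Sigma> vimage_def Int_def conj_commute)
qed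

lemma AE_recurrent_past: "AE \<omega> in M. recurrent_past G (\<lambda>n. z n \<omega>)"
proof -
  let ?A = "\<lambda>i. sigma_sets (space M) {z (- int i) -` S \<inter> space M | S. S \<in> UNIV}"
  let ?E = "{\<omega> \<in> space M. recurrent_past G (\<lambda>n. z n \<omega>)}"
  have E: "?E \<in> events"
    using past_event_recurrent_past by (intro path_event) (auto simp: past_event_def)
  have "prob ?E = 0 \<or> prob ?E = 1"
  proof (rule kolmogorov_0_1_law[of ?A])
    show "sigma_algebra (space M) (?A i)" for i
      by (rule sigma_algebra_sigma_sets) auto
    show "indep_sets ?A UNIV"
      using indep indep_sets_reindex[of "\<lambda>i. sigma_sets (space M) {z i -` S \<inter> space M | S. S \<in> UNIV}" "\<lambda>i. - int i"]
      by (simp add: indep_vars_def inj_on_def)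
    show "?E \<in> tail_events ?A"
      using past_event_in_tail[OF past_event_recurrent_past] by (simp add: tail_events_def)
  qed
  moreover have "prob ?E > 0"
  proof -
    \<comment> \<open>These events decrease to \<open>?E\<close>, and each contains the event that
      \<open>- n\<close> itself is a regeneration epoch, so the lower bound survives in the
      limit.\<close>
    let ?R = "\<lambda>n. {\<omega> \<in> space M. \<exists>k. emptied G (\<lambda>n. z n \<omega>) (- int n - int k)}"
    have R: "?R n \<in> events" for n
      by (rule path_event) measurable
    have dec: "decseq ?R"
    proof (rule decseq_SucI, safe)
      fix n \<omega> k assume "emptied G (\<lambda>n. z n \<omega>) (- int (Suc n) - int k)"
      moreover have "- int (Suc n) - int k = - int n - int (Suc k)" by simp
      ultimately show "\<exists>k. emptied G (\<lambda>n. z n \<omega>) (- int n - int k)" by metis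
    qed
    have "(\<lambda>n. prob (?R n)) \<longlonglongrightarrow> prob (\<Inter>n. ?R n)"
      using R dec by (intro finite_Lim_measure_decseq) auto
    moreover have "(\<Inter>n. ?R n) = ?E"
    proof (intro equalityI subsetI)
      fix \<omega> assume \<omega>: "\<omega> \<in> (\<Inter>n. ?R n)"
      have "\<exists>k. emptied G (\<lambda>n. z n \<omega>) (N - int k)" for N
      proof -
        obtain k where "emptied G (\<lambda>n. z n \<omega>) (- int (nat (- N)) - int k)" using \<omega> by blast
        moreover have "- int (nat (- N)) - int k = N - int (nat N + k)" by simp
        ultimately show ?thesis by metis
      qed
      then show "\<omega> \<in> ?E" using \<omega> by (auto simp: recurrent_past_def)
    qed (auto simp: recurrent_past_def)
    moreover have "pmf queue_pmf [] \<le> prob (?R n)" for n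
    proof -
      have "pmf queue_pmf [] \<le> prob {\<omega> \<in> space M. emptied G (\<lambda>n. z n \<omega>) (- int n)}"
        by (rule prob_emptied_ge)
      also have "\<dots> \<le> prob (?R n)"
        using R by (intro finite_measure_mono) (auto intro: exI[of _ 0])
      finally show ?thesis .
    qed
    ultimately have "pmf queue_pmf [] \<le> prob ?E"
      by (metis (no_types, lifting) LIMSEQ_le_const)
    then show ?thesis using queue_empty_pos by linarith
  qed
  ultimately have "prob ?E = 1" by linarith
  then show ?thesis using E by (simp add: prob_Collect_eq_1)
qed

text \<open>By stationarity, having no regeneration epoch in \<open>[N, N + m]\<close> is as likely
  as having none in \<open>[N - m, N]\<close>, and the latter probability tends to 0 by recurrence
  of the past.\<close>

lemma AE_recurrent_future: "AE \<omega> in M. recurrent_future G (\<lambda>n. z n \<omega>)"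
proof -
  have "AE \<omega> in M. \<exists>k. emptied G (\<lambda>n. z n \<omega>) (N + int k)" for N
  proof -
    let ?B = "\<lambda>m. {\<omega> \<in> space M. \<forall>k\<le>m. \<not> emptied G (\<lambda>n. z n \<omega>) (N - int k)}"
    let ?F = "{\<omega> \<in> space M. \<forall>k. \<not> emptied G (\<lambda>n. z n \<omega>) (N + int k)}"
    have B: "?B m \<in> events" for m
      by (rule path_event) measurable
    have F: "?F \<in> events"
      by (rule path_event) measurable
    have "(\<lambda>m. prob (?B m)) \<longlonglongrightarrow> prob (\<Inter>m. ?B m)"
      using B by (intro finite_Lim_measure_decseq) (auto simp: decseq_def)
    moreover have "prob (\<Inter>m. ?B m) = 0"
    proof -
      have "AE \<omega> in M. \<omega> \<notin> (\<Inter>m. ?B m)"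
        using AE_recurrent_past
      proof eventually_elim
        case (elim \<omega>)
        then obtain k where "emptied G (\<lambda>n. z n \<omega>) (N - int k)" unfolding recurrent_past_def by blast
        then show ?case by blast
      qed
      then show ?thesis using B by (intro prob_eq_0[THEN iffD2]) auto
    qed
    moreover have "prob ?F \<le> prob (?B m)" for m
    proof -
      let ?P = "\<lambda>z. \<forall>k\<le>m. \<not> emptied G z (N - int k)"
      have "prob ?F \<le> prob {\<omega> \<in> space M. ?P (\<lambda>n. z (n + int m) \<omega>)}"
      proof (rule finite_measure_mono)
        show "?F \<subseteq> {\<omega> \<in> space M. ?P (\<lambda>n. z (n + int m) \<omega>)}"
        proof safe
          fix \<omega> k assume "\<forall>k. \<not> emptied G (\<lambda>n. z n \<omega>) (N + int k)" "k \<le> m"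
            and E: "emptied G (\<lambda>n. z (n + int m) \<omega>) (N - int k)"
          then have "emptied G (\<lambda>n. z n \<omega>) (N + int (m - k))"
            using emptied_shift[of G "\<lambda>n. z n \<omega>" "int m" "N - int k"] by (simp add: of_nat_diff algebra_simps)
          then show False using \<open>\<forall>k. \<not> emptied G (\<lambda>n. z n \<omega>) (N + int k)\<close> by blast
        qed
        have "(\<lambda>\<omega> n. z (n + int m) \<omega>) \<in> M \<rightarrow>\<^sub>M paths"
          by (rule measurable_abs_UNIV) simp
        then show "{\<omega> \<in> space M. ?P (\<lambda>n. z (n + int m) \<omega>)} \<in> events"
          by measurable
      qed
      also have "\<dots> = prob (?B m)"
        by (rule prob_shift) measurable
      finally show ?thesis .
    qed
    ultimately have "prob ?F \<le> 0"
      by (metis (no_types, lifting) LIMSEQ_le_const)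
    then have "prob ?F = 0" by (simp add: measure_le_0_iff)
    then show ?thesis using F by (simp add: prob_eq_0)
  qed
  then show ?thesis
    unfolding recurrent_future_def by (subst AE_all_countable) simp
qed

end

section \<open>Law and Markov property of the aggregated process\<close>

context matching_process
begin

text \<open>A measurable version of \<open>X_state\<close>, equal to it almost surely.\<close>

definition X :: "int \<Rightarrow> 'w \<Rightarrow> 'c list" where
  "X N \<omega> = map snd (queue G (\<lambda>n. z n \<omega>) N)"

lemma measurable_X [measurable]: "X N \<in> M \<rightarrow>\<^sub>M count_space UNIV"
  unfolding X_def[abs_def] by measurable

lemma AE_X_Suc: "AE \<omega> in M. \<forall>N. X (N + 1) \<omega> = step G (z (N + 1) \<omega>) (X N \<omega>)"
  using AE_recurrent_past by eventually_elim (simp add: X_def queue_Suc map_snd_place)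

lemma prob_X_next:
  "prob {\<omega> \<in> space M. (\<forall>i\<le>n. Q i (X (N - int i) \<omega>)) \<and> A (X (N + 1) \<omega>)} =
    (\<Sum>i\<in>UNIV. rate i / total_rate *
      prob {\<omega> \<in> space M. (\<forall>i\<le>n. Q i (X (N - int i) \<omega>)) \<and> A (step G i (X N \<omega>))})"
proof -
  \<comment> \<open>The condition on the next state is tucked into the clause \<open>j = 0\<close>,
    so that the whole event has the form of a past event of the queues.\<close>
  let ?P = "\<lambda>i z. \<forall>j\<le>n. Q j (map snd (queue G z (N - int j))) \<and> (j = 0 \<longrightarrow> A (step G i (map snd (queue G z (N - int j)))))"
  have P: "?P i (\<lambda>n. z n \<omega>) \<longleftrightarrow> (\<forall>i\<le>n. Q i (X (N - int i) \<omega>)) \<and> A (step G i (X N \<omega>))" for i \<omega>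
    by (auto simp: X_def)
  have "prob {\<omega> \<in> space M. (\<forall>i\<le>n. Q i (X (N - int i) \<omega>)) \<and> A (X (N + 1) \<omega>)} =
      prob {\<omega> \<in> space M. ?P (z (N + 1) \<omega>) (\<lambda>n. z n \<omega>)}"
  proof (rule measure_eq_AE)
    show "AE \<omega> in M. \<omega> \<in> {\<omega> \<in> space M. (\<forall>i\<le>n. Q i (X (N - int i) \<omega>)) \<and> A (X (N + 1) \<omega>)} \<longleftrightarrow>
        \<omega> \<in> {\<omega> \<in> space M. ?P (z (N + 1) \<omega>) (\<lambda>n. z n \<omega>)}"
      using AE_X_Suc by eventually_elim (simp only: P mem_Collect_eq)
    show "{\<omega> \<in> space M. ?P (z (N + 1) \<omega>) (\<lambda>n. z n \<omega>)} \<in> events"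
      unfolding P by measurable
  qed measurable
  also have "\<dots> = (\<Sum>i\<in>UNIV. rate i / total_rate * prob {\<omega> \<in> space M. ?P i (\<lambda>n. z n \<omega>)})"
    by (rule prob_next_item, rule past_event_queues[where Q = "\<lambda>j q. Q j (map snd q) \<and> (j = 0 \<longrightarrow> A (step G _ (map snd q)))"])
  finally show ?thesis by (simp only: P)
qed

text \<open>Shift invariance makes the law of \<open>X\<close> the same at all times, one step of
  the chain therefore preserves it, and the stationary law is unique.\<close>

lemma law_X: "prob {\<omega> \<in> space M. X N \<omega> \<in> A} = measure queue_pmf A"
proof -
  have shift: "prob {\<omega> \<in> space M. X (N + d) \<omega> \<in> A} = prob {\<omega> \<in> space M. X N \<omega> \<in> A}" for N d A
    using prob_shift[of "\<lambda>z. map snd (queue G z N) \<in> A" d]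
    by (simp add: X_def map_snd_queue_shift[of G "\<lambda>n. z n _"])
  obtain p where p: "\<And>A. measure (measure_pmf p) A = prob {\<omega> \<in> space M. X 0 \<omega> \<in> A}"
    using pmf_of_random_variable[OF measurable_X] by blast
  have "stationary_distribution queue_kernel p"
    unfolding stationary_distribution_def
  proof (rule pmf_eqI)
    fix x
    have "pmf (bind_pmf p queue_kernel) x =
        (\<Sum>i\<in>UNIV. rate i / total_rate * prob {\<omega> \<in> space M. step G i (X 0 \<omega>) = x})"
      by (simp add: pmf_bind_kernel p)
    also have "\<dots> = prob {\<omega> \<in> space M. X (0 + 1) \<omega> = x}"
      using prob_X_next[of 0 "\<lambda>_ _. True" 0 "\<lambda>x'. x' = x"] by simp
    also have "\<dots> = pmf p x"
      using shift[of 0 1 "{x}"] p[of "{x}"] by (simp add: measure_pmf_single)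
    finally show "pmf (bind_pmf p queue_kernel) x = pmf p x" .
  qed
  then have "p = queue_pmf" by (rule queue_unique)
  then show ?thesis using p shift[of 0 N A] by simp
qed

definition history :: "nat \<Rightarrow> (nat \<Rightarrow> ('c \<times> nat) list) \<Rightarrow> int \<Rightarrow> 'w \<Rightarrow> bool" where
  "history n h N \<omega> \<longleftrightarrow> (\<forall>i\<le>n. aggregate (X (N - int i) \<omega>) = h i)"

lemma measurable_history [measurable]: "Measurable.pred M (history n h N)"
  unfolding history_def[abs_def] by measurable

lemma prob_history_next:
  "prob {\<omega> \<in> space M. history n h N \<omega> \<and> A (X (N + 1) \<omega>)} =
    (\<Sum>i\<in>UNIV. rate i / total_rate * prob {\<omega> \<in> space M. history n h N \<omega> \<and> A (step G i (X N \<omega>))})"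
  unfolding history_def by (rule prob_X_next)

lemma prob_history_sum:
  "prob {\<omega> \<in> space M. history n h N \<omega> \<and> A (X N \<omega>)} =
    (\<Sum>x | aggregate x = h 0 \<and> A x. prob {\<omega> \<in> space M. history n h N \<omega> \<and> X N \<omega> = x})"
proof -
  let ?S = "{x. aggregate x = h 0 \<and> A x}" and ?E = "\<lambda>x. {\<omega> \<in> space M. history n h N \<omega> \<and> X N \<omega> = x}"
  have fin: "finite ?S"
    by (rule finite_subset[OF _ finite_aggregate_vimage[of "h 0"]]) auto
  have "{\<omega> \<in> space M. history n h N \<omega> \<and> A (X N \<omega>)} = (\<Union>x\<in>?S. ?E x)"
    by (auto simp: history_def)
  moreover have "prob (\<Union>x\<in>?S. ?E x) = (\<Sum>x\<in>?S. prob (?E x))"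
    using fin by (intro finite_measure_finite_Union) (auto simp: disjoint_family_on_def)
  ultimately show ?thesis by simp
qed

text \<open>The constant \<open>g\<close> does not depend on \<open>x\<close>: the past of the aggregated chain carries no further
  information on the queue inside its current fibre. This makes the aggregated chain Markov although
  the forward chain is not lumpable.\<close>

lemma prob_history:
  "\<exists>g. \<forall>x. aggregate x = h 0 \<longrightarrow>
     prob {\<omega> \<in> space M. history n h N \<omega> \<and> X N \<omega> = x} = g * weight x"
proof (induction n arbitrary: h N)
  case 0
  have "prob {\<omega> \<in> space M. history 0 h N \<omega> \<and> X N \<omega> = x} = (1 / normalizer) * weight x"
    if "aggregate x = h 0" for x
  proof -
    have "{\<omega> \<in> space M. history 0 h N \<omega> \<and> X N \<omega> = x} = {\<omega> \<in> space M. X N \<omega> \<in> {x}}"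
      using that by (auto simp: history_def)
    then show ?thesis using law_X[of N "{x}"] by (simp add: measure_pmf_single pmf_queue)
  qed
  then show ?case by blast
next
  case (Suc n)
  define h' where "h' i = h (Suc i)" for i
  obtain g where g: "\<And>x. aggregate x = h' 0 \<Longrightarrow>
      prob {\<omega> \<in> space M. history n h' (N - 1) \<omega> \<and> X (N - 1) \<omega> = x} = g * weight x"
    using Suc[of h' "N - 1"] by blast
  obtain r where r: "\<And>x. aggregate x = h 0 \<Longrightarrow> inflow (\<lambda>x. aggregate x = h' 0) x = r * weight x"
    using inflow_proportional by blast
  have "prob {\<omega> \<in> space M. history (Suc n) h N \<omega> \<and> X N \<omega> = x} = (g * r / total_rate) * weight x"
    if x: "aggregate x = h 0" for x
  proof -
    have split: "(\<forall>i\<le>Suc n. P i) \<longleftrightarrow> P 0 \<and> (\<forall>i\<le>n. P (Suc i))" for P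
      unfolding less_Suc_eq_le[symmetric] by (rule All_less_Suc2)
    have pred: "N - int (Suc i) = N - 1 - int i" for i by simp
    have "history (Suc n) h N \<omega> \<and> X N \<omega> = x \<longleftrightarrow> history n h' (N - 1) \<omega> \<and> X (N - 1 + 1) \<omega> = x" for \<omega>
      using x unfolding history_def split h'_def pred by auto
    then have "prob {\<omega> \<in> space M. history (Suc n) h N \<omega> \<and> X N \<omega> = x} =
        prob {\<omega> \<in> space M. history n h' (N - 1) \<omega> \<and> X (N - 1 + 1) \<omega> = x}"
      by simp
    \<comment> \<open>By induction each predecessor in the fibre of \<open>h' 0\<close> has
      probability \<open>g\<close> times its weight, so the sum is a multiple of the inflow from
      that fibre, which \<open>r\<close> converts back into a multiple of
      \<open>weight x\<close>.\<close>
    also have "\<dots> = (\<Sum>i\<in>UNIV. rate i / total_rate *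
        (\<Sum>x' | aggregate x' = h' 0 \<and> step G i x' = x. g * weight x'))"
      unfolding prob_history_next[where A = "\<lambda>x'. x' = x"] prob_history_sum[where A = "\<lambda>x'. step G _ x' = x"]
      by (intro sum.cong refl arg_cong2[where f = "(*)"]) (auto simp: g)
    also have "\<dots> = g / total_rate * inflow (\<lambda>x. aggregate x = h' 0) x"
      by (simp add: inflow_def sum_distrib_left[symmetric] sum_distrib_left[where A = UNIV] conj_commute mult_ac)
    finally show ?thesis using r[OF x] by simp
  qed
  then show ?case by blast
qed

text \<open>Given any history of positive probability, the queue is distributed over the fibre of
  \<open>h 0\<close> in proportion to \<open>weight\<close>. This is the conditional law averaged in
  \<open>aggregate_kernel\<close>.\<close>

lemma aggregate_markov:
  "prob {\<omega> \<in> space M. history n h N \<omega> \<and> aggregate (X (N + 1) \<omega>) = y} =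
     prob {\<omega> \<in> space M. history n h N \<omega>} * pmf (aggregate_kernel (h 0)) y"
proof -
  obtain g where g: "\<And>x. aggregate x = h 0 \<Longrightarrow>
      prob {\<omega> \<in> space M. history n h N \<omega> \<and> X N \<omega> = x} = g * weight x"
    using prob_history by blast
  have "prob {\<omega> \<in> space M. history n h N \<omega> \<and> aggregate (X (N + 1) \<omega>) = y} =
     (\<Sum>i\<in>UNIV. rate i / total_rate * (\<Sum>x | aggregate x = h 0 \<and> aggregate (step G i x) = y. g * weight x))"
    unfolding prob_history_next[where A = "\<lambda>x. aggregate x = y"] prob_history_sum[where A = "\<lambda>x. aggregate (step G _ x) = y"]
    by (intro sum.cong refl arg_cong2[where f = "(*)"]) (auto simp: g)
  also have "\<dots> = g * (\<Sum>i\<in>UNIV. rate i / total_rate * (\<Sum>x | aggregate x = h 0 \<and> aggregate (step G i x) = y. weight x))"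
    by (simp add: sum_distrib_left[symmetric] sum_distrib_left[where A = UNIV] mult_ac)
  also have "\<dots> = g * (\<Sum>x | aggregate x = h 0. weight x) * pmf (aggregate_kernel (h 0)) y"
    by (simp only: aggregate_kernel_weight[symmetric] mult_ac)
  also have "g * (\<Sum>x | aggregate x = h 0. weight x) = prob {\<omega> \<in> space M. history n h N \<omega>}"
    using prob_history_sum[of n h N "\<lambda>_. True"] by (simp add: g sum_distrib_left)
  finally show ?thesis .
qed

lemma law_aggregate: "prob {\<omega> \<in> space M. aggregate (X N \<omega>) = y} = pmf aggregate_pmf y"
  using law_X[of N "{x. aggregate x = y}"] by (simp add: aggregate_pmf_def pmf_map vimage_def)

lemma AE_matching:
  "AE \<omega> in M. (\<exists>!A. perfect_fcfs_matching G (\<lambda>n. z n \<omega>) A) \<and>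
     (\<forall>N. Y_state G (\<lambda>n. z n \<omega>) N = aggregate (X N \<omega>))"
  using AE_recurrent_past AE_recurrent_future
  by eventually_elim (simp add: ex1_perfect_fcfs_matching Y_state_def X_state_eq_queue X_def)

text \<open>Events about \<open>Y_state\<close> agree with measurable ones only up to a null set;
  the completion makes them measurable without changing their probability.\<close>

lemma prob_completion:
  assumes "AE \<omega> in M. P \<omega> \<longleftrightarrow> Q \<omega>" "{\<omega> \<in> space M. Q \<omega>} \<in> events"
  shows "{\<omega> \<in> space M. P \<omega>} \<in> sets (completion M)"
    and "measure (completion M) {\<omega> \<in> space M. P \<omega>} = prob {\<omega> \<in> space M. Q \<omega>}"
proof -
  have AE: "AE \<omega> in completion M. \<omega> \<in> {\<omega> \<in> space M. Q \<omega>} \<longleftrightarrow> \<omega> \<in> {\<omega> \<in> space M. P \<omega>}"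
    by (rule AE_completion) (use assms(1) in eventually_elim, simp)
  show P: "{\<omega> \<in> space M. P \<omega>} \<in> sets (completion M)"
    by (rule completion.in_sets_AE[OF AE]) (use assms(2) in auto)
  have "measure (completion M) {\<omega> \<in> space M. P \<omega>} = measure (completion M) {\<omega> \<in> space M. Q \<omega>}"
    by (rule measure_eq_AE) (use AE P assms(2) in \<open>auto elim: AE_mp\<close>)
  then show "measure (completion M) {\<omega> \<in> space M. P \<omega>} = prob {\<omega> \<in> space M. Q \<omega>}"
    using assms(2) by simp
qed

lemma markov_chain_Y: "markov_chain (completion M) (\<lambda>N \<omega>. Y_state G (\<lambda>n. z n \<omega>) N) aggregate_kernel"
  unfolding markov_chain_def
proof (intro conjI allI)
  fix N
  have "{\<omega> \<in> space M. Y_state G (\<lambda>n. z n \<omega>) N \<in> S} \<in> sets (completion M)" for S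
  proof (rule prob_completion(1))
    show "AE \<omega> in M. (Y_state G (\<lambda>n. z n \<omega>) N \<in> S) = (aggregate (X N \<omega>) \<in> S)"
      using AE_matching by eventually_elim simp
  qed measurable
  then show "(\<lambda>\<omega>. Y_state G (\<lambda>n. z n \<omega>) N) \<in> completion M \<rightarrow>\<^sub>M count_space UNIV"
    by (auto simp: measurable_def vimage_def Int_def conj_commute)
next
  fix N n h y
  have "measure (completion M) {\<omega> \<in> space M. (\<forall>i\<le>n. Y_state G (\<lambda>n. z n \<omega>) (N - int i) = h i) \<and>
        Y_state G (\<lambda>n. z n \<omega>) (N + 1) = y} =
      prob {\<omega> \<in> space M. history n h N \<omega> \<and> aggregate (X (N + 1) \<omega>) = y}"
  proof (rule prob_completion(2))
    show "AE \<omega> in M. ((\<forall>i\<le>n. Y_state G (\<lambda>n. z n \<omega>) (N - int i) = h i) \<and> Y_state G (\<lambda>n. z n \<omega>) (N + 1) = y) \<longleftrightarrow>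
        history n h N \<omega> \<and> aggregate (X (N + 1) \<omega>) = y"
      using AE_matching by eventually_elim (simp add: history_def)
  qed measurable
  moreover have "measure (completion M) {\<omega> \<in> space M. \<forall>i\<le>n. Y_state G (\<lambda>n. z n \<omega>) (N - int i) = h i} =
      prob {\<omega> \<in> space M. history n h N \<omega>}"
  proof (rule prob_completion(2))
    show "AE \<omega> in M. (\<forall>i\<le>n. Y_state G (\<lambda>n. z n \<omega>) (N - int i) = h i) \<longleftrightarrow> history n h N \<omega>"
      using AE_matching by eventually_elim (simp add: history_def)
  qed measurable
  ultimately show "measure (completion M) {\<omega> \<in> space (completion M). (\<forall>i\<le>n. Y_state G (\<lambda>n. z n \<omega>) (N - int i) = h i) \<and>
        Y_state G (\<lambda>n. z n \<omega>) (N + 1) = y} =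
      measure (completion M) {\<omega> \<in> space (completion M). \<forall>i\<le>n. Y_state G (\<lambda>n. z n \<omega>) (N - int i) = h i} *
      pmf (aggregate_kernel (h 0)) y"
    by (simp only: space_completion aggregate_markov)
qed

lemma law_Y: "measure (completion M) {\<omega> \<in> space M. Y_state G (\<lambda>n. z n \<omega>) N = y} = pmf aggregate_pmf y"
  unfolding law_aggregate[of N, symmetric]
proof (rule prob_completion(2))
  show "AE \<omega> in M. Y_state G (\<lambda>n. z n \<omega>) N = y \<longleftrightarrow> aggregate (X N \<omega>) = y"
    using AE_matching by eventually_elim simp
qed measurable

end

lemma (in matching_rates) set_pmf_aggregate: "set_pmf aggregate_pmf \<subseteq> Y_states"
  by (auto simp: aggregate_pmf_def aggregate_in_Y_states)

theorem theorem6: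
  fixes G :: "('s::finite \<times> 'c::finite) set"
    and lbar mbar :: real
    and \<alpha> lam :: "'c \<Rightarrow> real"
    and \<beta> mu :: "'s \<Rightarrow> real"
    and M :: "'w measure"
    and z :: "int \<Rightarrow> 'w \<Rightarrow> ('c, 's) item"
  assumes rates_pos: "lbar > 0" "mbar > 0"
    and alpha: "\<And>c. \<alpha> c \<ge> 0" "(\<Sum>c\<in>UNIV. \<alpha> c) = 1"
    and beta: "\<And>s. \<beta> s \<ge> 0" "(\<Sum>s\<in>UNIV. \<beta> s) = 1"
    and lam: "\<And>c. lam c = lbar * \<alpha> c"
    and mu: "\<And>s. mu s = mbar * \<beta> s"
    and M: "prob_space M"
    and indep: "prob_space.indep_vars M (\<lambda>_. count_space UNIV) z UNIV"
    and law_agent: "\<And>n c. measure M {\<omega> \<in> space M. z n \<omega> = Agent c} = lam c / (lbar + mbar)"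
    and law_good: "\<And>n s. measure M {\<omega> \<in> space M. z n \<omega> = Good s} = mu s / (lbar + mbar)"
    and stability: "\<And>C. C \<noteq> {} \<Longrightarrow> sum lam C < sum mu (compatible_goods G C)"
  shows "(AE \<omega> in M. \<exists>!A. perfect_fcfs_matching G (\<lambda>n. z n \<omega>) A) \<and>
    (\<exists>K \<pi> B.
       markov_chain (completion M) (\<lambda>N \<omega>. Y_state G (\<lambda>n. z n \<omega>) N) K \<and>
       (\<forall>p. stationary_distribution K p \<longleftrightarrow> p = \<pi>) \<and>
       (\<forall>N y. measure (completion M) {\<omega> \<in> space M. Y_state G (\<lambda>n. z n \<omega>) N = y} = pmf \<pi> y) \<and>
       set_pmf \<pi> \<subseteq> Y_states \<and>
       (\<forall>y\<in>Y_states. pmf \<pi> y =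
          B * (\<Prod>l<length y.
                 lam (fst (y ! l)) / sum mu (compatible_goods G (fst ` set (take (Suc l) y))) *
                 (sum lam (fst ` set (take (Suc l) y)) /
                    sum mu (compatible_goods G (fst ` set (take (Suc l) y)))) ^ snd (y ! l))) \<and>
       pmf \<pi> [] = B \<and>
       B = inverse (\<Sum>k = 0..CARD('c). \<Sum>C | card C = k. \<Sum>cs\<in>permutations_of_set C.
                      \<Prod>l<k. lam (cs ! l) /
                        (sum mu (compatible_goods G (set (take (Suc l) cs))) -
                         sum lam (set (take (Suc l) cs)))))"
proof -
  interpret matching_rates G lam mu
    using rates_pos alpha(1) beta(1) stability by unfold_locales (auto simp: lam mu)
  \<comment> \<open>Both probability vectors have mass 1, which identifies the denominator
    \<open>lbar + mbar\<close> of the hypotheses with \<open>total_rate\<close>.\<close>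
  have "sum lam UNIV = lbar" "sum mu UNIV = mbar"
    using alpha(2) beta(2) by (simp_all add: lam mu sum_distrib_left[symmetric])
  then have total: "total_rate = lbar + mbar" by (simp add: total_rate_def)
  interpret prob_space M by (rule M)
  have law: "prob {\<omega> \<in> space M. z n \<omega> = i} = rate i / total_rate" for n i
    by (cases i) (simp_all add: law_agent law_good total)
  interpret matching_process G lam mu M z
    by unfold_locales (use indep law in auto)
  have normalizer: "normalizer = (\<Sum>k = 0..CARD('c). \<Sum>C | card C = k. \<Sum>cs\<in>permutations_of_set C.
                      \<Prod>l<k. lam (cs ! l) /
                        (sum mu (compatible_goods G (set (take (Suc l) cs))) -
                         sum lam (set (take (Suc l) cs))))"
    unfolding sum_permutations normalizer_def order_weight_def capacity_def ..
  have formula: "pmf aggregate_pmf y = inverse normalizer * aggregate_weight y" if "y \<in> Y_states" for y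
    using sum_weight_aggregate[OF that] by (simp add: pmf_aggregate field_simps)
  show ?thesis
  proof (intro conjI exI[of _ aggregate_kernel] exI[of _ aggregate_pmf] exI[of _ "inverse normalizer"])
    show "AE \<omega> in M. \<exists>!A. perfect_fcfs_matching G (\<lambda>n. z n \<omega>) A"
      using AE_matching by eventually_elim simp
    show "pmf aggregate_pmf [] = inverse normalizer"
      using formula[of "[]"] by (simp add: Y_states_def)
    show "inverse normalizer = inverse (\<Sum>k = 0..CARD('c). \<Sum>C | card C = k. \<Sum>cs\<in>permutations_of_set C.
                      \<Prod>l<k. lam (cs ! l) /
                        (sum mu (compatible_goods G (set (take (Suc l) cs))) -
                         sum lam (set (take (Suc l) cs))))"
      by (simp only: normalizer)
  qed (use markov_chain_Y aggregate_unique law_Y set_pmf_aggregate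
      formula[unfolded aggregate_weight_def capacity_def] in blast)+
qed

end
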